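(* Assume that $f$ is differentiable on $X$ and that for some $M_1>0$, $M_2>0$ and all $x\in X$ one has $$\mathbf{E}\Big[e^{(F(x,\xi)-f(x))^2/M_1^2}\Big]\le e,\qquad \mathbf{E}\Big[e^{L^2(x,\xi)/M_2^2}\Big]\le e .$$ Let $$\mathtt{Low}(\mu_1,N)=\mathrm{Opt}_N(\xi^N)-\frac{\mu_1M_1}{\sqrt N},\qquad \mathtt{Up}(\mu_2,s,\lambda,N)=\mathrm{Opt}_N(\xi^N)+\frac{\mu_2M_1+\left[\Omega(1+s^2)+2\lambda\right]M_2R}{\sqrt N}.$$ Then for all positive integers $N$, all $s>1$, $\lambda\ge0$ and $\mu_1,\mu_2\in[0,2\sqrt{\tau_*N}]$, $$\mathrm{Prob}\Big\{\mathrm{Opt}\in\big[\mathtt{Low}(\mu_1,N),\ \mathtt{Up}(\mu_2,s,\lambda,N)\big]\Big\}\ge1-\beta,$$ where $\beta=e^{-\frac{\mu_1^2}{4\tau_*}}+e^{-\frac{\mu_2^2}{4\tau_*}}+e^{-N(s^2-1)}+e^{-\frac{\lambda^2}{4\tau_*}}$.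
   Context: $E$ is a Euclidean space, $\|\cdot\|$ a norm on $E$ (not necessarily the Euclidean one), $B_{\|\cdot\|}$ its unit ball, and $\|y\|_*=\max_{\|x\|\le1}\langle x,y\rangle$ the conjugate norm. $\omega$ is a function continuously differentiable on $B_{\|\cdot\|}$, strongly convex with parameter one with respect to $\|\cdot\|$, i.e. $\langle\nabla\omega(x)-\nabla\omega(y),x-y\rangle\ge\|x-y\|^2$ for all $x,y\in B_{\|\cdot\|}$, and with $\omega(0)=0$, $\omega'(0)=0$. Set $\Omega=\max_{\|x\|\le1}\sqrt{2\omega(x)}$. $X\subset E$ is a nonempty convex compact set, and $R$ is the smallest radius of a $\|\cdot\|$-ball containing $X$. $P$ is a Borel probability distribution on $\mathbf{R}^k$ with support $\Xi$, $\xi\sim P$, and $F:E\times\Xi\to\mathbf{R}$ is a Borel function, convex in $x\in E$ and such that $F(x,\cdot)$ is $P$-summable for every $x\in E$. Set $f(x)=\mathbf{E}\{F(x,\xi)\}$ (a convex function on $E$) and $$L(x,\xi)=\max\{\|g-h\|_*:\ g\in\partial_xF(x,\xi),\ h\in\partial f(x)\}.$$ Let $\mathrm{Opt}=\min_{x\in X}f(x)$ and $\mathrm{Opt}_N(\xi^N)=\min_{x\in X}\frac1N\sum_{t=1}^NF(x,\xi_t)$, where $\xi^N=(\xi_1,\dots,\xi_N)$ and $\xi_1,\xi_2,\dots$ are drawn independently from $P$. $\tau_*=0.557409\ldots$ is the smallest positive real such that $e^t\le t+e^{\tau_*t^2}$ for all $t\in\mathbf{R}$. *)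

theory Defs
  imports "HOL-Probability.Probability"
begin

(* Under the hypotheses of the theorem, every SUP/INF below (at sample points in the support)
   is an attained maximum/minimum, and both LEASTs exist. *)

definition is_norm :: "('a::real_vector \<Rightarrow> real) \<Rightarrow> bool" where
  "is_norm nrm \<longleftrightarrow>
     (\<forall>x. nrm x \<ge> 0) \<and> (\<forall>x. nrm x = 0 \<longleftrightarrow> x = 0) \<and>
     (\<forall>c x. nrm (c *\<^sub>R x) = \<bar>c\<bar> * nrm x) \<and>
     (\<forall>x y. nrm (x + y) \<le> nrm x + nrm y)"

definition nball :: "('a::real_vector \<Rightarrow> real) \<Rightarrow> 'a \<Rightarrow> real \<Rightarrow> 'a set" where
  "nball nrm c r = {x. nrm (x - c) \<le> r}"

definition conj_norm :: "('a::euclidean_space \<Rightarrow> real) \<Rightarrow> 'a \<Rightarrow> real" where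
  "conj_norm nrm y = (SUP x\<in>nball nrm 0 1. x \<bullet> y)"

(* The gradient g is taken relative to the unit ball; it is uniquely determined on the ball,
   which is convex with nonempty interior. Values of \<omega> outside the ball play no role. *)
definition distance_generating ::
    "('a::euclidean_space \<Rightarrow> real) \<Rightarrow> ('a \<Rightarrow> real) \<Rightarrow> bool" where
  "distance_generating nrm \<omega> \<longleftrightarrow>
     (\<exists>g. (\<forall>x\<in>nball nrm 0 1. (\<omega> has_derivative (\<lambda>h. g x \<bullet> h)) (at x within nball nrm 0 1)) \<and>
          continuous_on (nball nrm 0 1) g \<and>
          (\<forall>x\<in>nball nrm 0 1. \<forall>y\<in>nball nrm 0 1. (g x - g y) \<bullet> (x - y) \<ge> (nrm (x - y))\<^sup>2) \<and>
          \<omega> 0 = 0 \<and> g 0 = 0)"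

definition Omega_const :: "('a::real_vector \<Rightarrow> real) \<Rightarrow> ('a \<Rightarrow> real) \<Rightarrow> real" where
  "Omega_const nrm \<omega> = (SUP x\<in>nball nrm 0 1. sqrt (2 * \<omega> x))"

definition min_radius :: "('a::real_vector \<Rightarrow> real) \<Rightarrow> 'a set \<Rightarrow> real" where
  "min_radius nrm X = (LEAST r. \<exists>c. X \<subseteq> nball nrm c r)"

definition msupport :: "'b::topological_space measure \<Rightarrow> 'b set" where
  "msupport P = \<Inter>{C. closed C \<and> emeasure P (- C) = 0}"

(* F x \<xi> is meaningful only for \<xi> in the support of P, which has full measure; hence the
   integral over the support. *)
definition mean_fun :: "'b::topological_space measure \<Rightarrow> ('a \<Rightarrow> 'b \<Rightarrow> real) \<Rightarrow> 'a \<Rightarrow> real" where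
  "mean_fun P F x = (LINT \<xi>:msupport P|P. F x \<xi>)"

definition subdiff :: "('a::real_inner \<Rightarrow> real) \<Rightarrow> 'a \<Rightarrow> 'a set" where
  "subdiff \<phi> x = {g. \<forall>y. \<phi> y \<ge> \<phi> x + g \<bullet> (y - x)}"

definition subgrad_dev ::
    "('a::euclidean_space \<Rightarrow> real) \<Rightarrow> 'b::topological_space measure \<Rightarrow> ('a \<Rightarrow> 'b \<Rightarrow> real) \<Rightarrow> 'a \<Rightarrow> 'b \<Rightarrow> real"
  where
  "subgrad_dev nrm P F x \<xi> =
     Sup {conj_norm nrm (g - h) | g h. g \<in> subdiff (\<lambda>y. F y \<xi>) x \<and> h \<in> subdiff (mean_fun P F) x}"

definition Opt :: "'b::topological_space measure \<Rightarrow> ('a \<Rightarrow> 'b \<Rightarrow> real) \<Rightarrow> 'a set \<Rightarrow> real" where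
  "Opt P F X = (INF x\<in>X. mean_fun P F x)"

definition Opt_SAA :: "('a \<Rightarrow> 'b \<Rightarrow> real) \<Rightarrow> 'a set \<Rightarrow> nat \<Rightarrow> (nat \<Rightarrow> 'b) \<Rightarrow> real" where
  "Opt_SAA F X N z = (INF x\<in>X. (1 / real N) * (\<Sum>t=1..N. F x (z t)))"

definition tau_star :: real where
  "tau_star = (LEAST \<tau>. \<tau> > 0 \<and> (\<forall>t::real. exp t \<le> t + exp (\<tau> * t\<^sup>2)))"

definition Low ::
    "('a \<Rightarrow> 'b \<Rightarrow> real) \<Rightarrow> 'a set \<Rightarrow> real \<Rightarrow> real \<Rightarrow> nat \<Rightarrow> (nat \<Rightarrow> 'b) \<Rightarrow> real" where
  "Low F X M1 \<mu>1 N z = Opt_SAA F X N z - \<mu>1 * M1 / sqrt (real N)"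

definition Up ::
    "('a::real_vector \<Rightarrow> real) \<Rightarrow> ('a \<Rightarrow> real) \<Rightarrow> ('a \<Rightarrow> 'b \<Rightarrow> real) \<Rightarrow> 'a set \<Rightarrow> real \<Rightarrow> real \<Rightarrow>
     real \<Rightarrow> real \<Rightarrow> real \<Rightarrow> nat \<Rightarrow> (nat \<Rightarrow> 'b) \<Rightarrow> real" where
  "Up nrm \<omega> F X M1 M2 \<mu>2 s l N z =
     Opt_SAA F X N z +
     (\<mu>2 * M1 + (Omega_const nrm \<omega> * (1 + s\<^sup>2) + 2 * l) * M2 * min_radius nrm X) / sqrt (real N)"

end

theory Submission
  imports Defs
begin

text \<open>
  Let \<open>x0\<close> minimize \<open>f\<close> over \<open>X\<close>, let \<open>h\<close> be the gradient of \<open>f\<close> at \<open>x0\<close> and let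
  \<open>f_N\<close> be the sample average, so that the two confidence limits are obtained by comparing \<open>min f_N\<close> with
  \<open>f x0\<close>.

  One direction is immediate: \<open>min f_N \<le> f_N x0\<close>, and \<open>f_N x0 - f x0\<close> is an average of independent
  centred variables. For the other direction let \<open>g\<close> pick a subgradient of \<open>F _ z\<close> at \<open>x0\<close>. Since
  \<open>f\<close> is differentiable at \<open>x0\<close>, the mean of \<open>g\<close> is \<open>h\<close> (\<open>mean_subgradient_selection\<close>), and
  \<open>h \<bullet> (x - x0) \<ge> 0\<close> on \<open>X\<close> by optimality. Convexity then bounds \<open>f_N x\<close> below by
  \<open>f_N x0\<close> minus the average of \<open>\<Delta> t \<bullet> (x - x0)\<close>, where the \<open>\<Delta> t = h - g (\<xi> t)\<close> are
  independent and centred. What remains is a bound on this average uniformly in \<open>x\<close>.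

  The uniform bound comes from an online-learning argument: dual averaging, run on the random vectors
  \<open>\<Delta> t\<close>, produces points \<open>v t\<close> of the unit ball that depend on the past only, and its regret
  bound (\<open>dual_averaging_regret\<close>) is a deterministic inequality that holds for all comparison points
  at once. It replaces the supremum over \<open>x\<close> by the sum of the squared conjugate norms of \<open>\<Delta> t\<close>
  and by one martingale, the sum of the \<open>\<Delta> t \<bullet> (v t - y0)\<close>, where \<open>y0\<close> is the position of
  \<open>x0\<close> in the enclosing ball, rescaled to the unit ball (\<open>SAA_lower_bound\<close>).

  All four random sums are controlled by exponential moments (\<open>adapted_sum_tail_bound\<close>). For the centred
  ones the input is \<open>E exp (\<theta> * \<eta>) \<le> exp (tau_star * \<theta>\<^sup>2)\<close> whenever
  \<open>E \<eta> = 0\<close> and \<open>E exp (\<eta>\<^sup>2) \<le> e\<close> (\<open>mgf_le_exp_tau_star\<close>). As \<open>l\<close> is an arbitrary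
  nonnegative number, this is needed for every \<open>\<theta> \<ge> 0\<close>, and not just in the range
  \<open>tau_star * \<theta>\<^sup>2 \<le> 1\<close> where the definition of \<open>tau_star\<close> yields it directly; an
  interpolation covers the rest (\<open>exp_mult_le_linear_plus_exp_square\<close>).
\<close>

section \<open>The constant \<open>tau_star\<close> and the moment generating function\<close>

text \<open>
  The value 1 is admissible in the definition of \<open>tau_star\<close>; this makes the set of admissible
  values nonempty, so that its infimum exists.
\<close>
lemma exp_le_self_plus_exp_square: "exp t \<le> t + exp (t\<^sup>2)" for t :: real
proof -
  consider "\<bar>t\<bar> \<le> 1" | "t > 1" | "t < -1" by linarith
  then show ?thesis
  proof cases
    case 1
    have "exp t \<le> 1 + t + t\<^sup>2"
    proof (cases "t \<ge> 0")
      case True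
      then show ?thesis using 1 exp_bound[of t] by auto
    next
      case False
      then have "1 + (-t) + (-t)\<^sup>2 / 2 \<le> exp (-t)"
        using exp_lower_Taylor_quadratic[of "-t"] by auto
      then have "exp t * (1 - t + t\<^sup>2 / 2) \<le> exp t * exp (-t)"
        by (intro mult_left_mono) auto
      then have A: "exp t * (1 - t + t\<^sup>2 / 2) \<le> 1" by (simp add: exp_minus)
      have pos: "1 - t + t\<^sup>2 / 2 > 0" using False zero_le_power2[of t] by linarith
      have "(1 + t + t\<^sup>2) * (1 - t + t\<^sup>2 / 2) = 1 + t\<^sup>2 / 2 * (1 - t) + t^4 / 2"
        by (simp add: field_simps power2_eq_square power4_eq_xxxx)
      also have "\<dots> \<ge> 1" using False by auto
      finally have "exp t * (1 - t + t\<^sup>2 / 2) \<le> (1 + t + t\<^sup>2) * (1 - t + t\<^sup>2 / 2)"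
        using A by linarith
      then show ?thesis using pos by (simp add: mult_le_cancel_right)
    qed
    also have "\<dots> \<le> t + exp (t\<^sup>2)"
      using exp_ge_add_one_self[of "t\<^sup>2"] by linarith
    finally show ?thesis .
  next
    case 2
    then have "t \<le> t\<^sup>2" by (simp add: power2_eq_square)
    then have "exp t \<le> exp (t\<^sup>2)" by simp
    then show ?thesis using 2 by linarith
  next
    case 3
    then have "- t \<le> t\<^sup>2" using mult_mono[of 1 "-t" "-t" "-t"] by (simp add: power2_eq_square)
    moreover have "exp t \<le> 1" using 3 by simp
    ultimately show ?thesis using exp_ge_add_one_self[of "t\<^sup>2"] by linarith
  qed
qed

text \<open>
  Comparing the second-order terms at 0 on both sides. In \<open>tau_star_props\<close> the bound keeps
  the infimum of the admissible values away from 0, so that it is itself admissible; in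
  \<open>exp_mult_le_linear_plus_exp_square\<close> it is what makes the large values of \<open>\<theta>\<close> work.
\<close>
lemma half_le_if_exp_le_self_plus_exp:
  fixes \<tau> :: real
  assumes "\<And>t::real. exp t \<le> t + exp (\<tau> * t\<^sup>2)" "\<tau> > 0"
  shows "1/2 \<le> \<tau>"
proof (rule ccontr)
  assume "\<not> ?thesis"
  then have t: "\<tau> < 1/2" by simp
  \<comment> \<open>Any small \<open>u = t\<^sup>2\<close> gives a contradiction; this one reduces it to \<open>1 \<le> \<tau>\<^sup>2\<close>.\<close>
  define u where "u = 1/2 - \<tau>"
  have u: "0 < u" "u < 1/2" using t assms(2) by (auto simp: u_def)
  have "1 + sqrt u + (sqrt u)\<^sup>2 / 2 \<le> exp (sqrt u)"
    using u by (intro exp_lower_Taylor_quadratic) auto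
  also have "\<dots> \<le> sqrt u + exp (\<tau> * u)" using assms(1)[of "sqrt u"] u by simp
  also have "exp (\<tau> * u) \<le> 1 + \<tau> * u + (\<tau> * u)\<^sup>2"
    using u assms(2) t by (intro exp_bound) (auto simp: mult_le_one)
  finally have "u / 2 \<le> \<tau> * u + (\<tau> * u)\<^sup>2" using u by simp
  then have "u * (1/2) \<le> u * (\<tau> + \<tau>\<^sup>2 * u)" by (simp add: algebra_simps power2_eq_square)
  then have "1/2 \<le> \<tau> + \<tau>\<^sup>2 * u" using u by simp
  then have "u * 1 \<le> u * \<tau>\<^sup>2" by (simp add: u_def algebra_simps)
  then have "1 \<le> \<tau>\<^sup>2" using u by (simp only: mult_le_cancel_left_pos)
  moreover have "\<tau>\<^sup>2 < 1" using t assms(2) by (simp add: power_less_one_iff)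
  ultimately show False by simp
qed

lemma tau_star_props:
  shows tau_star_pos: "tau_star > 0"
    and exp_le_tau_star: "\<And>t. exp t \<le> t + exp (tau_star * t\<^sup>2)"
    and tau_star_ge_half: "1/2 \<le> tau_star"
proof -
  define S where "S = {\<tau>::real. \<tau> > 0 \<and> (\<forall>t::real. exp t \<le> t + exp (\<tau> * t\<^sup>2))}"
  have one: "1 \<in> S" using exp_le_self_plus_exp_square by (auto simp: S_def)
  have low: "1/2 \<le> \<tau>" if "\<tau> \<in> S" for \<tau> using that half_le_if_exp_le_self_plus_exp by (auto simp: S_def)
  have bdd: "bdd_below S" using low by (rule bdd_belowI)
  have "S = {1/2..} \<inter> (\<Inter>t. {\<tau>. exp t \<le> t + exp (\<tau> * t\<^sup>2)})"
    using low by (fastforce simp: S_def)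
  moreover have "closed \<dots>"
    by (intro closed_Int closed_INT ballI closed_Collect_le continuous_intros)
  ultimately have "closed S" by (simp only:)
  then have "Inf S \<in> S"
    using closed_contains_Inf[of S] bdd one by blast
  moreover have "Inf S \<le> \<tau>" if "\<tau> \<in> S" for \<tau> using that bdd by (rule cInf_lower)
  ultimately have "(LEAST \<tau>. \<tau> > 0 \<and> (\<forall>t::real. exp t \<le> t + exp (\<tau> * t\<^sup>2))) = Inf S"
    by (intro Least_equality) (auto simp: S_def)
  then have "tau_star \<in> S" using \<open>Inf S \<in> S\<close> by (simp add: tau_star_def)
  then show "tau_star > 0" "\<And>t. exp t \<le> t + exp (tau_star * t\<^sup>2)" "1/2 \<le> tau_star"
    using low by (auto simp: S_def)
qed

lemma exp_convex_combination:
  fixes a x y :: real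
  assumes "0 \<le> a" "a \<le> 1"
  shows "exp ((1 - a) * x + a * y) \<le> (1 - a) * exp x + a * exp y"
  using convex_onD[OF exp_convex, of a x y] assms by auto

text \<open>
  A pointwise bound that can be integrated against any centred \<open>\<eta>\<close> with
  \<open>E exp(\<eta>\<^sup>2) \<le> e\<close>: the linear term vanishes and the rest gives \<open>k1 + k2 * e\<close>.

  With \<open>c = 1 / sqrt tau_star\<close> there are three regimes. For \<open>\<theta> \<le> c\<close> the defining inequality of
  \<open>tau_star\<close> is combined with the tangent bound for the concave power \<open>a = tau_star * \<theta>\<^sup>2 \<le> 1\<close> of \<open>exp (x\<^sup>2)\<close>. For \<open>\<theta> \<ge> 2 * c\<close> the
  elementary \<open>\<theta> * x \<le> \<theta>\<^sup>2 / 4 + x\<^sup>2\<close> is strong enough. In between, the exponent at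
  \<open>\<theta> = c * (1 + \<alpha>)\<close> is interpolated between its values at \<open>c\<close> and \<open>2 * c\<close>; the interpolated constant
  \<open>1 + \<alpha> * c\<^sup>2\<close> stays below \<open>tau_star * \<theta>\<^sup>2 = (1 + \<alpha>)\<^sup>2\<close> because
  \<open>c\<^sup>2 \<le> 2\<close>, which is \<open>tau_star \<ge> 1/2\<close>.
\<close>
lemma exp_mult_le_linear_plus_exp_square:
  fixes \<theta> :: real
  assumes "0 \<le> \<theta>"
  obtains b k1 k2 :: real where
    "\<And>x. exp (\<theta> * x) \<le> b * x + k1 + k2 * exp (x\<^sup>2)"
    "k1 + k2 * exp 1 \<le> exp (tau_star * \<theta>\<^sup>2)" "0 \<le> k2"
proof -
  note tau = tau_star_pos exp_le_tau_star tau_star_ge_half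
  define c where "c = 1 / sqrt tau_star"
  have c: "c > 0" "tau_star * c\<^sup>2 = 1" "c\<^sup>2 \<le> 2"
    using tau by (auto simp: c_def power_divide field_simps)
  define \<alpha> where "\<alpha> = \<theta> / c - 1"
  have \<theta>: "\<theta> = c * (1 + \<alpha>)" using c by (simp add: \<alpha>_def)
  have t\<theta>: "tau_star * \<theta>\<^sup>2 = (1 + \<alpha>)\<^sup>2"
    using c by (simp add: \<theta> power_mult_distrib)
  \<comment> \<open>\<open>\<alpha> < 0\<close>, \<open>0 \<le> \<alpha> \<le> 1\<close> and \<open>\<alpha> > 1\<close> are the three regimes.\<close>
  consider "tau_star * \<theta>\<^sup>2 \<le> 1" | "0 \<le> \<alpha>" "\<alpha> \<le> 1" | "1 < \<alpha>"
  proof -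
    have "(1 + \<alpha>)\<^sup>2 \<le> 1\<^sup>2" if "\<alpha> < 0"
      using that \<theta> assms c by (intro power_mono) (auto simp: zero_le_mult_iff)
    then show ?thesis using that t\<theta> by fastforce
  qed
  then show thesis
  proof cases
    case 1
    define a where "a = tau_star * \<theta>\<^sup>2"
    have a: "0 \<le> a" "a \<le> 1" using 1 tau by (auto simp: a_def)
    have "exp (\<theta> * x) \<le> \<theta> * x + exp a * (1 - a) + exp a * a * exp (-1) * exp (x\<^sup>2)" for x
    proof -
      have "exp (\<theta> * x) \<le> \<theta> * x + exp (a * x\<^sup>2)"
        using tau(2)[of "\<theta> * x"] by (simp add: a_def power_mult_distrib mult_ac)
      also have "exp (a * x\<^sup>2) = exp a * exp ((1 - a) * 0 + a * (x\<^sup>2 - 1))"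
        by (simp flip: exp_add add: algebra_simps)
      also have "\<dots> \<le> exp a * ((1 - a) * exp 0 + a * exp (x\<^sup>2 - 1))"
        using a by (intro mult_left_mono exp_convex_combination) auto
      also have "exp (x\<^sup>2 - 1) = exp (-1) * exp (x\<^sup>2)" by (simp flip: exp_add)
      finally show ?thesis by (simp add: algebra_simps)
    qed
    moreover have "exp a * (1 - a) + exp a * a * exp (-1) * exp 1 = exp a"
      by (simp add: exp_minus algebra_simps)
    ultimately show thesis using that[of \<theta> "exp a * (1 - a)" "exp a * a * exp (-1)"] a
      by (simp add: a_def)
  next
    case 2
    define K where "K = 1 + \<alpha> * c\<^sup>2"
    have "exp (\<theta> * x) \<le> (exp K * (1 - \<alpha>) * c * exp (-1)) * x + 0 + exp K * exp (-1) * exp (x\<^sup>2)" for x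
    proof -
      have "exp (\<theta> * x) = exp K * exp ((1 - \<alpha>) * (c * x - 1) + \<alpha> * (2 * c * x - c\<^sup>2 - 1))"
        by (simp flip: exp_add add: K_def \<theta> algebra_simps)
      also have "\<dots> \<le> exp K * ((1 - \<alpha>) * exp (c * x - 1) + \<alpha> * exp (2 * c * x - c\<^sup>2 - 1))"
        using 2 by (intro mult_left_mono exp_convex_combination) auto
      also have "\<dots> \<le> exp K * ((1 - \<alpha>) * (exp (-1) * (c * x + exp (x\<^sup>2))) + \<alpha> * (exp (-1) * exp (x\<^sup>2)))"
      proof (intro mult_left_mono add_mono)
        have "exp (c * x) \<le> c * x + exp (x\<^sup>2)"
          using tau(2)[of "c * x"] c by (simp add: power_mult_distrib flip: mult.assoc)
        then have "exp (-1) * exp (c * x) \<le> exp (-1) * (c * x + exp (x\<^sup>2))"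
          by (intro mult_left_mono) auto
        then show "exp (c * x - 1) \<le> exp (-1) * (c * x + exp (x\<^sup>2))"
          by (simp flip: exp_add)
        have "0 \<le> (x - c)\<^sup>2" by simp
        then show "exp (2 * c * x - c\<^sup>2 - 1) \<le> exp (-1) * exp (x\<^sup>2)"
          by (simp flip: exp_add add: power2_eq_square algebra_simps)
      qed (use 2 in auto)
      finally show ?thesis by (simp add: algebra_simps)
    qed
    moreover have "0 + exp K * exp (-1) * exp 1 \<le> exp (tau_star * \<theta>\<^sup>2)"
    proof -
      have "\<alpha> * c\<^sup>2 \<le> \<alpha> * 2" using c 2 by (intro mult_left_mono) auto
      moreover have "(1 + \<alpha>)\<^sup>2 = 1 + \<alpha> * 2 + \<alpha>\<^sup>2" by (simp add: power2_eq_square algebra_simps)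
      ultimately have "K \<le> (1 + \<alpha>)\<^sup>2" unfolding K_def using zero_le_power2[of \<alpha>] by linarith
      then show ?thesis by (simp add: t\<theta> mult.assoc flip: exp_add)
    qed
    ultimately show thesis
      by (intro that[of "exp K * (1 - \<alpha>) * c * exp (-1)" 0 "exp K * exp (-1)"]) auto
  next
    case 3
    have "exp (\<theta> * x) \<le> 0 * x + 0 + exp (\<theta>\<^sup>2 / 4) * exp (x\<^sup>2)" for x
    proof -
      have "0 \<le> (\<theta> / 2 - x)\<^sup>2" by simp
      then have "\<theta> * x \<le> \<theta>\<^sup>2 / 4 + x\<^sup>2" by (simp add: power2_eq_square algebra_simps)
      then show ?thesis by (simp flip: exp_add)
    qed
    moreover have "0 + exp (\<theta>\<^sup>2 / 4) * exp 1 \<le> exp (tau_star * \<theta>\<^sup>2)"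
    proof -
      have "1/2 * \<theta>\<^sup>2 \<le> tau_star * \<theta>\<^sup>2" using tau by (intro mult_right_mono) auto
      moreover have "2\<^sup>2 \<le> (1 + \<alpha>)\<^sup>2" using 3 by (intro power_mono) auto
      ultimately have "\<theta>\<^sup>2 / 4 + 1 \<le> tau_star * \<theta>\<^sup>2" unfolding t\<theta> by simp
      then show ?thesis by (simp flip: exp_add)
    qed
    ultimately show thesis by (intro that[of 0 0 "exp (\<theta>\<^sup>2 / 4)"]) auto
  qed
qed

lemma (in prob_space) mgf_le_exp_tau_star:
  fixes \<eta> :: "'a \<Rightarrow> real"
  assumes int: "integrable M \<eta>" and mean: "expectation \<eta> = 0"
    and sq: "(\<integral>\<^sup>+x. ennreal (exp ((\<eta> x)\<^sup>2)) \<partial>M) \<le> ennreal (exp 1)"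
    and "0 \<le> \<theta>"
  shows "(\<integral>\<^sup>+x. ennreal (exp (\<theta> * \<eta> x)) \<partial>M) \<le> ennreal (exp (tau_star * \<theta>\<^sup>2))"
proof -
  obtain b k1 k2 :: real where k: "\<And>x. exp (\<theta> * x) \<le> b * x + k1 + k2 * exp (x\<^sup>2)"
    "k1 + k2 * exp 1 \<le> exp (tau_star * \<theta>\<^sup>2)" "0 \<le> k2"
    using exp_mult_le_linear_plus_exp_square[OF \<open>0 \<le> \<theta>\<close>] by blast
  have [measurable]: "\<eta> \<in> borel_measurable M" using int by auto
  have int2: "integrable M (\<lambda>x. exp ((\<eta> x)\<^sup>2))"
    using sq by (intro integrableI_nonneg) (auto simp: order.strict_trans1)
  have "ennreal (expectation (\<lambda>x. exp ((\<eta> x)\<^sup>2))) \<le> ennreal (exp 1)"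
    using sq nn_integral_eq_integral[OF int2] by simp
  then have e: "expectation (\<lambda>x. exp ((\<eta> x)\<^sup>2)) \<le> exp 1" by simp
  have "(\<integral>\<^sup>+x. ennreal (exp (\<theta> * \<eta> x)) \<partial>M) \<le> (\<integral>\<^sup>+x. ennreal (b * \<eta> x + k1 + k2 * exp ((\<eta> x)\<^sup>2)) \<partial>M)"
    by (intro nn_integral_mono ennreal_leI k)
  also have "\<dots> = ennreal (\<integral>x. b * \<eta> x + k1 + k2 * exp ((\<eta> x)\<^sup>2) \<partial>M)"
  proof (intro nn_integral_eq_integral AE_I2)
    show "integrable M (\<lambda>x. b * \<eta> x + k1 + k2 * exp ((\<eta> x)\<^sup>2))"
      using int int2 by simp
    show "0 \<le> b * \<eta> x + k1 + k2 * exp ((\<eta> x)\<^sup>2)" for x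
      by (rule order_trans[OF exp_ge_zero k(1)])
  qed
  also have "(\<integral>x. b * \<eta> x + k1 + k2 * exp ((\<eta> x)\<^sup>2) \<partial>M) = k1 + k2 * expectation (\<lambda>x. exp ((\<eta> x)\<^sup>2))"
    using int int2 mean by (simp add: prob_space)
  also have "\<dots> \<le> k1 + k2 * exp 1" using e k(3) by (intro add_left_mono mult_left_mono) auto
  also have "\<dots> \<le> exp (tau_star * \<theta>\<^sup>2)" by (rule k(2))
  finally show ?thesis by (simp add: ennreal_leI)
qed

section \<open>Exponential tail bounds for adapted sums\<close>

text \<open>
  The usual conditioning argument for supermartingales, on a product space: factor \<open>t\<close> depends
  on the coordinates \<open>1..t\<close> only, so integrating out the last coordinate first costs one factor \<open>K\<close>.
\<close>
lemma nn_integral_prod_adapted_le: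
  fixes G :: "nat \<Rightarrow> (nat \<Rightarrow> 'b) \<Rightarrow> ennreal" and P :: "'b measure"
  assumes "prob_space P"
    and meas: "\<And>n t. t \<in> {1..n} \<Longrightarrow> G t \<in> borel_measurable (PiM {1..n} (\<lambda>_. P))"
    and dep: "\<And>t w w'. t \<ge> 1 \<Longrightarrow> (\<forall>s\<in>{1..t}. w s = w' s) \<Longrightarrow> G t w = G t w'"
    and bound: "\<And>t w. t \<ge> 1 \<Longrightarrow> (\<integral>\<^sup>+y. G t (w(t := y)) \<partial>P) \<le> K"
  shows "(\<integral>\<^sup>+w. (\<Prod>t\<in>{1..n}. G t w) \<partial>PiM {1..n} (\<lambda>_. P)) \<le> K ^ n"
proof (induction n)
  interpret P: prob_space P by fact
  interpret product_sigma_finite "\<lambda>_::nat. P" by standard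
  case 0
  show ?case by (simp add: PiM_empty nn_integral_count_space_finite)
next
  interpret P: prob_space P by fact
  interpret product_sigma_finite "\<lambda>_::nat. P" by standard
  case (Suc n)
  have I: "{1..Suc n} = insert (Suc n) {1..n}" by auto
  have m: "(\<lambda>w. \<Prod>t\<in>{1..Suc n}. G t w) \<in> borel_measurable (PiM {1..Suc n} (\<lambda>_. P))"
    by (intro borel_measurable_prod_ennreal meas)
  have "(\<integral>\<^sup>+w. (\<Prod>t\<in>{1..Suc n}. G t w) \<partial>PiM {1..Suc n} (\<lambda>_. P))
      = (\<integral>\<^sup>+x. (\<integral>\<^sup>+y. (\<Prod>t\<in>{1..Suc n}. G t (x(Suc n := y))) \<partial>P) \<partial>PiM {1..n} (\<lambda>_. P))"
    unfolding I by (rule product_nn_integral_insert[OF _ _ m[unfolded I]]) auto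
  also have "\<dots> \<le> (\<integral>\<^sup>+x. (\<Prod>t\<in>{1..n}. G t x) * K \<partial>PiM {1..n} (\<lambda>_. P))"
  proof (intro nn_integral_mono)
    fix x assume x: "x \<in> space (PiM {1..n} (\<lambda>_. P))"
    have upd: "(\<lambda>y. x(Suc n := y)) \<in> measurable P (PiM {1..Suc n} (\<lambda>_. P))"
      using x unfolding I by (intro measurable_fun_upd[where J="{1..n}"]) auto
    have G: "G t (x(Suc n := y)) = G t x" if "t \<in> {1..n}" for t y
      using that by (intro dep) auto
    have "(\<integral>\<^sup>+y. (\<Prod>t\<in>{1..Suc n}. G t (x(Suc n := y))) \<partial>P)
        = (\<integral>\<^sup>+y. (\<Prod>t\<in>{1..n}. G t x) * G (Suc n) (x(Suc n := y)) \<partial>P)"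
      unfolding I by (intro nn_integral_cong) (simp add: G mult.commute)
    also have "\<dots> = (\<Prod>t\<in>{1..n}. G t x) * (\<integral>\<^sup>+y. G (Suc n) (x(Suc n := y)) \<partial>P)"
      by (intro nn_integral_cmult measurable_compose[OF upd] meas) auto
    also have "\<dots> \<le> (\<Prod>t\<in>{1..n}. G t x) * K"
      by (intro mult_left_mono bound) auto
    finally show "(\<integral>\<^sup>+y. (\<Prod>t\<in>{1..Suc n}. G t (x(Suc n := y))) \<partial>P) \<le> (\<Prod>t\<in>{1..n}. G t x) * K" .
  qed
  also have "\<dots> = (\<integral>\<^sup>+x. (\<Prod>t\<in>{1..n}. G t x) \<partial>PiM {1..n} (\<lambda>_. P)) * K"
    by (intro nn_integral_multc borel_measurable_prod_ennreal meas) auto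
  also have "\<dots> \<le> K ^ n * K" by (intro mult_right_mono Suc.IH) auto
  finally show ?case by (simp add: mult.commute)
qed

text \<open>
  Markov's inequality for \<open>exp (\<theta> * sum)\<close>.
\<close>
lemma adapted_sum_tail_bound:
  fixes Y :: "nat \<Rightarrow> (nat \<Rightarrow> 'b) \<Rightarrow> real" and P :: "'b measure"
  assumes P: "prob_space P"
    and meas: "\<And>n t. t \<in> {1..n} \<Longrightarrow> Y t \<in> borel_measurable (PiM {1..n} (\<lambda>_. P))"
    and dep: "\<And>t w w'. t \<ge> 1 \<Longrightarrow> (\<forall>s\<in>{1..t}. w s = w' s) \<Longrightarrow> Y t w = Y t w'"
    and bound: "\<And>t w. t \<ge> 1 \<Longrightarrow> (\<integral>\<^sup>+y. ennreal (exp (\<theta> * Y t (w(t := y)))) \<partial>P) \<le> ennreal (exp k)"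
    and "0 \<le> \<theta>"
  shows "measure (PiM {1..n} (\<lambda>_. P)) {w \<in> space (PiM {1..n} (\<lambda>_. P)). a < (\<Sum>t\<in>{1..n}. Y t w)}
           \<le> exp (real n * k - \<theta> * a)" (is "measure ?Q ?A \<le> _")
proof -
  interpret P: prob_space P by fact
  interpret product_sigma_finite "\<lambda>_::nat. P" by standard
  interpret Q: prob_space ?Q by (intro prob_space_PiM P)
  have [measurable]: "(\<lambda>w. \<Sum>t\<in>{1..n}. Y t w) \<in> borel_measurable ?Q"
    by (intro borel_measurable_sum meas)
  have "emeasure ?Q ?A = (\<integral>\<^sup>+w. indicator ?A w \<partial>?Q)"
    by (rule nn_integral_indicator[symmetric]) measurable
  also have "\<dots> \<le> (\<integral>\<^sup>+w. ennreal (exp (- \<theta> * a)) * (\<Prod>t\<in>{1..n}. ennreal (exp (\<theta> * Y t w))) \<partial>?Q)"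
  proof (intro nn_integral_mono)
    fix w assume "w \<in> space ?Q"
    have "(1::real) \<le> exp (\<theta> * (\<Sum>t\<in>{1..n}. Y t w) - \<theta> * a)" if "a < (\<Sum>t\<in>{1..n}. Y t w)"
      using that \<open>0 \<le> \<theta>\<close> by (simp add: mult_left_mono)
    also have "exp (\<theta> * (\<Sum>t\<in>{1..n}. Y t w) - \<theta> * a)
        = exp (- \<theta> * a) * (\<Prod>t\<in>{1..n}. exp (\<theta> * Y t w))"
      by (simp add: exp_diff exp_minus sum_distrib_left exp_sum divide_inverse)
    finally show "indicator ?A w \<le> ennreal (exp (- \<theta> * a)) * (\<Prod>t\<in>{1..n}. ennreal (exp (\<theta> * Y t w)))"
      by (auto simp: indicator_def prod_ennreal prod_nonneg ennreal_1[symmetric]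
               simp del: ennreal_1 simp flip: ennreal_mult intro!: ennreal_leI)
  qed
  also have "\<dots> = ennreal (exp (- \<theta> * a)) * (\<integral>\<^sup>+w. (\<Prod>t\<in>{1..n}. ennreal (exp (\<theta> * Y t w))) \<partial>?Q)"
    using meas by (intro nn_integral_cmult borel_measurable_prod_ennreal) simp
  also have "\<dots> \<le> ennreal (exp (- \<theta> * a)) * ennreal (exp k) ^ n"
  proof (intro mult_left_mono nn_integral_prod_adapted_le[OF P])
    show "(\<lambda>w. ennreal (exp (\<theta> * Y t w))) \<in> borel_measurable (PiM {1..m} (\<lambda>_. P))" if "t \<in> {1..m}" for m t
      using meas[OF that] by simp
    show "ennreal (exp (\<theta> * Y t w)) = ennreal (exp (\<theta> * Y t w'))"
      if "t \<ge> 1" "\<forall>s\<in>{1..t}. w s = w' s" for t w w'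
      using dep[OF that] by simp
  qed (use bound in auto)
  also have "\<dots> = ennreal (exp (real n * k - \<theta> * a))"
    by (simp add: ennreal_power exp_of_nat_mult[symmetric] ennreal_mult[symmetric] exp_add[symmetric])
  finally show ?thesis unfolding Q.emeasure_eq_measure by simp
qed

text \<open>
  The sub-Gaussian bound with variance proxy \<open>2 * tau_star\<close>, for martingale differences; it holds
  for every \<open>\<mu> \<ge> 0\<close> because the moment generating function is controlled at every \<open>\<theta> \<ge> 0\<close>.
\<close>
lemma adapted_mean_zero_tail_bound:
  fixes Y :: "nat \<Rightarrow> (nat \<Rightarrow> 'b) \<Rightarrow> real" and P :: "'b measure"
  assumes P: "prob_space P"
    and meas: "\<And>n t. t \<in> {1..n} \<Longrightarrow> Y t \<in> borel_measurable (PiM {1..n} (\<lambda>_. P))"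
    and dep: "\<And>t w w'. t \<ge> 1 \<Longrightarrow> (\<forall>s\<in>{1..t}. w s = w' s) \<Longrightarrow> Y t w = Y t w'"
    and int: "\<And>t w. t \<ge> 1 \<Longrightarrow> integrable P (\<lambda>y. Y t (w(t := y)))"
    and mean: "\<And>t w. t \<ge> 1 \<Longrightarrow> (\<integral>y. Y t (w(t := y)) \<partial>P) = 0"
    and sq: "\<And>t w. t \<ge> 1 \<Longrightarrow> (\<integral>\<^sup>+y. ennreal (exp ((Y t (w(t := y)))\<^sup>2)) \<partial>P) \<le> ennreal (exp 1)"
    and "0 \<le> \<mu>" "n > 0"
  shows "measure (PiM {1..n} (\<lambda>_. P))
           {w \<in> space (PiM {1..n} (\<lambda>_. P)). \<mu> * sqrt (real n) < (\<Sum>t\<in>{1..n}. Y t w)}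
           \<le> exp (- (\<mu>\<^sup>2 / (4 * tau_star)))"
proof -
  interpret P: prob_space P by fact
  \<comment> \<open>The minimizer of the Chernoff exponent \<open>n * tau_star * \<theta>\<^sup>2 - \<theta> * \<mu> * sqrt n\<close>.\<close>
  define \<theta> where "\<theta> = \<mu> / (2 * tau_star * sqrt (real n))"
  have \<theta>: "0 \<le> \<theta>" using \<open>0 \<le> \<mu>\<close> tau_star_pos by (simp add: \<theta>_def)
  have s: "sqrt (real n) > 0" using \<open>n > 0\<close> by simp
  have "real n * (tau_star * \<theta>\<^sup>2) = \<mu>\<^sup>2 / (4 * tau_star)"
    using tau_star_pos \<open>n > 0\<close> by (simp add: \<theta>_def power_divide power_mult_distrib field_simps power2_eq_square)
  moreover have "\<theta> * (\<mu> * sqrt (real n)) = \<mu>\<^sup>2 / (2 * tau_star)"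
    using tau_star_pos s by (simp add: \<theta>_def field_simps power2_eq_square)
  moreover have "\<mu>\<^sup>2 / (4 * tau_star) - \<mu>\<^sup>2 / (2 * tau_star) = - (\<mu>\<^sup>2 / (4 * tau_star))"
    using tau_star_pos by (simp add: field_simps)
  ultimately have e: "real n * (tau_star * \<theta>\<^sup>2) - \<theta> * (\<mu> * sqrt (real n)) = - (\<mu>\<^sup>2 / (4 * tau_star))"
    by simp
  show ?thesis
    unfolding e[symmetric]
    by (intro adapted_sum_tail_bound P meas dep \<theta> P.mgf_le_exp_tau_star int mean sq) auto
qed

section \<open>Norms, conjugate norms and smallest enclosing balls\<close>

lemma is_norm_nonneg: "is_norm nrm \<Longrightarrow> 0 \<le> nrm x"
  and is_norm_eq_0: "is_norm nrm \<Longrightarrow> nrm x = 0 \<longleftrightarrow> x = 0"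
  and is_norm_scaleR: "is_norm nrm \<Longrightarrow> nrm (c *\<^sub>R x) = \<bar>c\<bar> * nrm x"
  and is_norm_triangle: "is_norm nrm \<Longrightarrow> nrm (x + y) \<le> nrm x + nrm y"
  by (auto simp: is_norm_def)

lemma is_norm_zero [simp]: "is_norm nrm \<Longrightarrow> nrm 0 = 0"
  by (simp add: is_norm_eq_0)

lemma is_norm_minus: "is_norm nrm \<Longrightarrow> nrm (- x) = nrm x"
  using is_norm_scaleR[of nrm "-1" x] by simp

lemma is_norm_triangle_diff: "is_norm nrm \<Longrightarrow> nrm (x - y) \<le> nrm x + nrm y"
  using is_norm_triangle[of nrm x "- y"] by (simp add: is_norm_minus)

lemma is_norm_convex: "is_norm nrm \<Longrightarrow> convex_on UNIV nrm"
  by (intro convex_onI) (auto intro: order_trans[OF is_norm_triangle] simp: is_norm_scaleR)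

lemma is_norm_continuous_on:
  fixes nrm :: "'a::euclidean_space \<Rightarrow> real"
  assumes "is_norm nrm"
  shows "continuous_on S nrm"
  using convex_on_continuous[OF open_UNIV is_norm_convex[OF assms]] continuous_on_subset by blast

lemma is_norm_ge_multiple_of_norm:
  fixes nrm :: "'a::euclidean_space \<Rightarrow> real"
  assumes "is_norm nrm"
  obtains m where "m > 0" "\<And>x. m * norm x \<le> nrm x"
proof -
  have "\<exists>x\<in>sphere 0 1. \<forall>y\<in>sphere 0 1. nrm x \<le> nrm (y :: 'a)"
    by (intro continuous_attains_inf is_norm_continuous_on assms) auto
  then obtain x :: 'a where x: "norm x = 1" "\<And>y. norm y = 1 \<Longrightarrow> nrm x \<le> nrm y" by auto
  have "nrm x > 0"
    using x(1) is_norm_nonneg[OF assms, of x] is_norm_eq_0[OF assms, of x] by force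
  moreover have "nrm x * norm y \<le> nrm y" for y
  proof (cases "y = 0")
    case False
    then have "nrm x \<le> nrm ((1 / norm y) *\<^sub>R y)" by (intro x(2)) auto
    then show ?thesis using False by (simp add: is_norm_scaleR[OF assms] field_simps)
  qed (use assms in simp)
  ultimately show thesis by (rule that)
qed

lemma convex_nball:
  assumes "is_norm nrm"
  shows "convex (nball nrm 0 r)"
proof (rule convexI)
  fix x y and u v :: real
  assume xy: "x \<in> nball nrm 0 r" "y \<in> nball nrm 0 r" and uv: "0 \<le> u" "0 \<le> v" "u + v = 1"
  have "nrm (u *\<^sub>R x + v *\<^sub>R y) \<le> u * nrm x + v * nrm y"
    using is_norm_triangle[OF assms, of "u *\<^sub>R x" "v *\<^sub>R y"] uv by (simp add: is_norm_scaleR[OF assms])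
  also have "\<dots> \<le> u * r + v * r"
    using xy uv by (intro add_mono mult_left_mono) (auto simp: nball_def)
  also have "\<dots> = r" using uv by (simp flip: distrib_right)
  finally show "u *\<^sub>R x + v *\<^sub>R y \<in> nball nrm 0 r" by (simp add: nball_def)
qed

lemma compact_nball:
  fixes nrm :: "'a::euclidean_space \<Rightarrow> real"
  assumes "is_norm nrm"
  shows "compact (nball nrm 0 r)"
proof -
  obtain m where m: "m > 0" "\<And>x. m * norm x \<le> nrm x"
    using is_norm_ge_multiple_of_norm[OF assms] by blast
  have "closed (nball nrm 0 r)"
    unfolding nball_def
    by (intro closed_Collect_le continuous_intros is_norm_continuous_on[OF assms]) (auto intro: is_norm_continuous_on[OF assms])
  moreover have "bounded (nball nrm 0 r)"
    unfolding bounded_iff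
  proof (intro exI[of _ "r / m"] ballI)
    fix x assume "x \<in> nball nrm 0 r"
    then show "norm x \<le> r / m" using m(1) m(2)[of x] by (auto simp: nball_def field_simps)
  qed
  ultimately show ?thesis by (simp add: compact_eq_bounded_closed)
qed

lemma bdd_above_inner_nball:
  fixes nrm :: "'a::euclidean_space \<Rightarrow> real"
  assumes "is_norm nrm"
  shows "bdd_above ((\<lambda>x. x \<bullet> y) ` nball nrm 0 1)"
  by (intro bounded_imp_bdd_above compact_imp_bounded compact_continuous_image compact_nball
      continuous_intros assms)

lemma inner_le_nrm_mult_conj_norm:
  fixes nrm :: "'a::euclidean_space \<Rightarrow> real"
  assumes "is_norm nrm"
  shows "x \<bullet> y \<le> nrm x * conj_norm nrm y"
proof (cases "x = 0")
  case False
  then have n: "nrm x > 0" using is_norm_nonneg[OF assms, of x] is_norm_eq_0[OF assms, of x] by force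
  then have "(1 / nrm x) *\<^sub>R x \<in> nball nrm 0 1" by (simp add: nball_def is_norm_scaleR[OF assms])
  then have "((1 / nrm x) *\<^sub>R x) \<bullet> y \<le> conj_norm nrm y"
    unfolding conj_norm_def by (intro cSUP_upper bdd_above_inner_nball assms)
  then show ?thesis using n by (simp add: field_simps)
qed (use assms in simp)

lemma abs_inner_le_nrm_mult_conj_norm:
  fixes nrm :: "'a::euclidean_space \<Rightarrow> real"
  assumes "is_norm nrm"
  shows "\<bar>x \<bullet> y\<bar> \<le> nrm x * conj_norm nrm y"
  using inner_le_nrm_mult_conj_norm[OF assms, of x y] inner_le_nrm_mult_conj_norm[OF assms, of "-x" y]
  by (auto simp: is_norm_minus[OF assms] abs_le_iff)

lemma zero_in_nball: "is_norm nrm \<Longrightarrow> 0 \<in> nball nrm 0 1"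
  by (simp add: nball_def)

lemma conj_norm_nonneg:
  fixes nrm :: "'a::euclidean_space \<Rightarrow> real"
  assumes "is_norm nrm"
  shows "0 \<le> conj_norm nrm y"
  using cSUP_upper[OF zero_in_nball bdd_above_inner_nball, of nrm y] assms by (simp add: conj_norm_def)

lemma conj_norm_leI:
  assumes "is_norm nrm" "\<And>x. nrm x \<le> 1 \<Longrightarrow> x \<bullet> y \<le> K"
  shows "conj_norm nrm y \<le> K"
  unfolding conj_norm_def
  using zero_in_nball[OF assms(1)] by (intro cSUP_least) (auto simp: nball_def intro: assms(2))

lemma conj_norm_le_multiple_of_norm:
  fixes nrm :: "'a::euclidean_space \<Rightarrow> real"
  assumes "is_norm nrm"
  obtains C where "\<And>y. conj_norm nrm y \<le> C * norm y"
proof -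
  obtain m where m: "m > 0" "\<And>x. m * norm x \<le> nrm x"
    using is_norm_ge_multiple_of_norm[OF assms] by blast
  have "conj_norm nrm y \<le> 1 / m * norm y" for y
  proof (rule conj_norm_leI[OF assms])
    fix x assume "nrm x \<le> 1"
    then have "norm x \<le> 1 / m" using m(1) m(2)[of x] by (simp add: field_simps)
    then show "x \<bullet> y \<le> 1 / m * norm y"
      by (intro order_trans[OF norm_cauchy_schwarz] mult_right_mono) auto
  qed
  then show thesis by (rule that)
qed

lemma conj_norm_borel_measurable:
  fixes nrm :: "'a::euclidean_space \<Rightarrow> real"
  assumes "is_norm nrm"
  shows "conj_norm nrm \<in> borel_measurable borel"
proof -
  have "convex_on UNIV (conj_norm nrm)"
  proof (intro convex_onI)
    fix t :: real and y z :: 'a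
    assume t: "0 < t" "t < 1"
    show "conj_norm nrm ((1 - t) *\<^sub>R y + t *\<^sub>R z) \<le> (1 - t) * conj_norm nrm y + t * conj_norm nrm z"
    proof (rule conj_norm_leI[OF assms])
      fix x assume x: "nrm x \<le> 1"
      have b: "x \<bullet> y \<le> conj_norm nrm y" for y
        unfolding conj_norm_def using x
        by (intro cSUP_upper bdd_above_inner_nball assms) (simp add: nball_def)
      have "(1 - t) * (x \<bullet> y) + t * (x \<bullet> z) \<le> (1 - t) * conj_norm nrm y + t * conj_norm nrm z"
        using t by (intro add_mono mult_left_mono b) auto
      then show "x \<bullet> ((1 - t) *\<^sub>R y + t *\<^sub>R z) \<le> (1 - t) * conj_norm nrm y + t * conj_norm nrm z"
        by (simp add: inner_add_right)
    qed
  qed simp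
  then show ?thesis
    by (intro borel_measurable_continuous_onI convex_on_continuous open_UNIV)
qed

text \<open>
  The pairs (centre, radius) of enclosing balls of radius at most \<open>r0\<close> form a compact set, so the
  radius attains its minimum on it; hence the \<open>LEAST\<close> in the definition of \<open>min_radius\<close> exists.
\<close>
lemma min_radius_attained:
  fixes nrm :: "'a::euclidean_space \<Rightarrow> real"
  assumes "is_norm nrm" "compact X" "X \<noteq> {}"
  obtains c where "X \<subseteq> nball nrm c (min_radius nrm X)" "0 \<le> min_radius nrm X"
proof -
  obtain x0 where x0: "x0 \<in> X" using assms(3) by blast
  obtain m where m: "m > 0" "\<And>x. m * norm x \<le> nrm x"
    using is_norm_ge_multiple_of_norm[OF assms(1)] by blast
  have cont: "continuous_on S (\<lambda>x. nrm (g x))" if "continuous_on S g" for S and g :: "'z::topological_space \<Rightarrow> 'a"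
    by (rule continuous_on_compose2[OF is_norm_continuous_on[OF assms(1), of UNIV] that]) auto
  obtain r0 where "\<forall>y\<in>nrm ` X. \<bar>y\<bar> \<le> r0"
    using compact_imp_bounded[OF compact_continuous_image[OF is_norm_continuous_on[OF assms(1)] assms(2)]]
    unfolding bounded_real by blast
  then have r0: "\<And>x. x \<in> X \<Longrightarrow> nrm x \<le> r0" by force
  define T where "T = {(c, r). X \<subseteq> nball nrm c r \<and> r \<le> r0}"
  have T: "T = (\<Inter>x\<in>X. {p. nrm (x - fst p) \<le> snd p}) \<inter> {p. snd p \<le> r0}"
    by (auto simp: T_def nball_def)
  have "closed T"
    unfolding T by (intro closed_Int closed_INT ballI closed_Collect_le continuous_intros cont)
  moreover have "bounded T"
  proof -
    have "norm (fst p) \<le> (nrm x0 + r0) / m \<and> \<bar>snd p\<bar> \<le> \<bar>r0\<bar>" if "p \<in> T" for p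
    proof -
      have "nrm (x0 - fst p) \<le> snd p" "snd p \<le> r0" using that x0 by (auto simp: T)
      moreover have "nrm (fst p) \<le> nrm x0 + nrm (x0 - fst p)"
        using is_norm_triangle_diff[OF assms(1), of x0 "x0 - fst p"] by simp
      ultimately show ?thesis
        using is_norm_nonneg[OF assms(1), of "x0 - fst p"] m(1) m(2)[of "fst p"]
        by (auto simp: field_simps)
    qed
    then have "T \<subseteq> cball 0 ((nrm x0 + r0) / m) \<times> cball 0 \<bar>r0\<bar>"
      by (force simp: mem_Times_iff)
    then show ?thesis by (rule bounded_subset[OF bounded_Times[OF bounded_cball bounded_cball]])
  qed
  ultimately have "compact T" by (simp add: compact_eq_bounded_closed)
  moreover have "(0, r0) \<in> T" using r0 by (auto simp: T_def nball_def)
  ultimately obtain p where p: "p \<in> T" "\<And>q. q \<in> T \<Longrightarrow> snd p \<le> snd q"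
    using continuous_attains_inf[of T snd] continuous_on_snd[OF continuous_on_id] by (metis empty_iff)
  have pX: "X \<subseteq> nball nrm (fst p) (snd p)" using p(1) by (auto simp: T_def)
  have "min_radius nrm X = snd p"
    unfolding min_radius_def
  proof (intro Least_equality)
    show "\<exists>c. X \<subseteq> nball nrm c (snd p)" using pX by blast
    fix r assume "\<exists>c. X \<subseteq> nball nrm c r"
    then obtain c where c: "X \<subseteq> nball nrm c r" by blast
    show "snd p \<le> r"
    proof (cases "r \<le> r0")
      case True
      then show ?thesis using p(2)[of "(c, r)"] c by (auto simp: T_def)
    next
      case False
      then show ?thesis using p(1) by (auto simp: T_def)
    qed
  qed
  moreover have "0 \<le> snd p"
    using pX x0 is_norm_nonneg[OF assms(1), of "x0 - fst p"]
    by (force simp: nball_def)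
  ultimately show thesis using that[of "fst p"] pX by simp
qed

section \<open>Subgradients of convex functions and of their means\<close>

text \<open>
  A subgradient \<open>g\<close> forces the function to rise by \<open>norm g\<close> at distance 1 in the direction of
  \<open>g\<close>, whereas the function is bounded on the unit ball around \<open>x\<close>.
\<close>
lemma bounded_subdiff:
  fixes \<phi> :: "'a::euclidean_space \<Rightarrow> real"
  assumes "convex_on UNIV \<phi>"
  shows "bounded (subdiff \<phi> x)"
proof -
  have "compact (\<phi> ` cball x 1)"
    using convex_on_continuous[OF open_UNIV assms]
    by (intro compact_continuous_image) (auto intro: continuous_on_subset)
  then obtain K where K: "\<And>y. y \<in> cball x 1 \<Longrightarrow> \<bar>\<phi> y\<bar> \<le> K"
    using compact_imp_bounded by (force simp: bounded_real)
  have "norm g \<le> K - \<phi> x" if g: "g \<in> subdiff \<phi> x" for g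
  proof (cases "g = 0")
    case True
    then show ?thesis using K[of x] by simp
  next
    case False
    define y where "y = x + (1 / norm g) *\<^sub>R g"
    have "\<phi> x + g \<bullet> (y - x) \<le> \<phi> y" using g by (auto simp: subdiff_def)
    moreover have "g \<bullet> (y - x) = norm g"
      using False by (simp add: y_def dot_square_norm power2_eq_square)
    moreover have "\<bar>\<phi> y\<bar> \<le> K" using False by (intro K) (simp add: y_def dist_norm)
    ultimately show ?thesis by simp
  qed
  then show ?thesis unfolding bounded_iff by blast
qed

text \<open>
  The supremum defining \<open>subgrad_dev\<close> is taken over a bounded set, since both subdifferentials
  are bounded.
\<close>
lemma conj_norm_le_subgrad_dev:
  fixes nrm :: "'a::euclidean_space \<Rightarrow> real"
  assumes "is_norm nrm" "convex_on UNIV (\<lambda>y. F y z)" "convex_on UNIV (mean_fun P F)"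
    and "g \<in> subdiff (\<lambda>y. F y z) x" "h \<in> subdiff (mean_fun P F) x"
  shows "conj_norm nrm (g - h) \<le> subgrad_dev nrm P F x z"
  unfolding subgrad_dev_def
proof (intro cSup_upper)
  obtain C where C: "\<And>y. conj_norm nrm y \<le> C * norm y"
    using conj_norm_le_multiple_of_norm[OF assms(1)] by blast
  obtain A B where A: "\<And>g. g \<in> subdiff (\<lambda>y. F y z) x \<Longrightarrow> norm g \<le> A"
    and B: "\<And>h. h \<in> subdiff (mean_fun P F) x \<Longrightarrow> norm h \<le> B"
    using bounded_subdiff[OF assms(2)] bounded_subdiff[OF assms(3)] unfolding bounded_iff by metis
  have "conj_norm nrm (g - h) \<le> \<bar>C\<bar> * (A + B)"
    if "g \<in> subdiff (\<lambda>y. F y z) x" "h \<in> subdiff (mean_fun P F) x" for g h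
  proof -
    have "conj_norm nrm (g - h) \<le> \<bar>C\<bar> * norm (g - h)"
      by (rule order_trans[OF C]) (simp add: mult_right_mono)
    also have "\<dots> \<le> \<bar>C\<bar> * (A + B)"
      using A[OF that(1)] B[OF that(2)] norm_triangle_ineq4[of g h] by (intro mult_left_mono) auto
    finally show ?thesis .
  qed
  then show "bdd_above {conj_norm nrm (g - h) |g h.
      g \<in> subdiff (\<lambda>y. F y z) x \<and> h \<in> subdiff (mean_fun P F) x}"
    unfolding bdd_above_def by blast
qed (use assms(4,5) in blast)

text \<open>
  Difference quotients along the steps \<open>1 / (n + 1)\<close>. Countably many steps suffice to reach
  directional derivatives, and they keep all limits below measurable.
\<close>
definition slope_seq :: "('a::real_vector \<Rightarrow> real) \<Rightarrow> 'a \<Rightarrow> 'a \<Rightarrow> nat \<Rightarrow> real" where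
  "slope_seq \<phi> x e n = real (Suc n) * (\<phi> (x + (1 / real (Suc n)) *\<^sub>R e) - \<phi> x)"

lemma slope_seq_0 [simp]: "slope_seq \<phi> x e 0 = \<phi> (x + e) - \<phi> x"
  by (simp add: slope_seq_def)

lemma convex_le_slope_seq:
  fixes \<phi> :: "'a::real_vector \<Rightarrow> real"
  assumes "convex_on UNIV \<phi>" "0 \<le> t" "t \<le> 1 / real (Suc n)"
  shows "\<phi> (x + t *\<^sub>R e) \<le> \<phi> x + t * slope_seq \<phi> x e n"
proof -
  define a where "a = t * real (Suc n)"
  have a: "0 \<le> a" "a \<le> 1" using assms(2,3) by (auto simp: a_def field_simps)
  have "\<phi> ((1 - a) *\<^sub>R x + a *\<^sub>R (x + (1 / real (Suc n)) *\<^sub>R e)) \<le> (1 - a) * \<phi> x + a * \<phi> (x + (1 / real (Suc n)) *\<^sub>R e)"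
    using convex_onD[OF assms(1)] a by auto
  moreover have "(1 - a) *\<^sub>R x + a *\<^sub>R (x + (1 / real (Suc n)) *\<^sub>R e) = x + (a * (1 / real (Suc n))) *\<^sub>R e"
    by (simp add: scaleR_add_right scaleR_diff_left)
  moreover have "a * (1 / real (Suc n)) = t" by (simp add: a_def)
  moreover have "(1 - a) * \<phi> x + a * \<phi> (x + (1 / real (Suc n)) *\<^sub>R e) = \<phi> x + t * slope_seq \<phi> x e n"
    by (simp only: slope_seq_def a_def) (simp add: algebra_simps)
  ultimately show ?thesis by simp
qed

lemma decseq_slope_seq:
  fixes \<phi> :: "'a::real_vector \<Rightarrow> real"
  assumes "convex_on UNIV \<phi>"
  shows "decseq (slope_seq \<phi> x e)"
proof (rule decseq_SucI)
  fix n
  have "\<phi> (x + (1 / real (Suc (Suc n))) *\<^sub>R e) \<le> \<phi> x + 1 / real (Suc (Suc n)) * slope_seq \<phi> x e n"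
    by (intro convex_le_slope_seq assms) (auto simp: field_simps)
  then show "slope_seq \<phi> x e (Suc n) \<le> slope_seq \<phi> x e n"
    unfolding slope_seq_def[of _ _ _ "Suc n"] by (simp add: field_simps)
qed

lemma slope_seq_opposite:
  fixes \<phi> :: "'a::real_vector \<Rightarrow> real"
  assumes "convex_on UNIV \<phi>"
  shows "0 \<le> slope_seq \<phi> x e n + slope_seq \<phi> x (- e) n"
proof -
  define y z where "y = x + (1 / real (Suc n)) *\<^sub>R e" and "z = x + (1 / real (Suc n)) *\<^sub>R (- e)"
  have "\<phi> ((1 - 1/2) *\<^sub>R y + (1/2) *\<^sub>R z) \<le> (1 - 1/2) * \<phi> y + 1/2 * \<phi> z"
    by (rule convex_onD[OF assms]) auto
  moreover have "(1 - 1/2) *\<^sub>R y + (1/2) *\<^sub>R z = x"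
    by (simp add: y_def z_def flip: scaleR_add_right scaleR_add_left)
  ultimately have "0 \<le> (\<phi> y - \<phi> x) + (\<phi> z - \<phi> x)" by simp
  then have "0 \<le> real (Suc n) * ((\<phi> y - \<phi> x) + (\<phi> z - \<phi> x))" by (intro mult_nonneg_nonneg) auto
  then show ?thesis unfolding slope_seq_def y_def z_def by (simp only: distrib_left)
qed

lemma abs_slope_seq_le:
  fixes \<phi> :: "'a::real_vector \<Rightarrow> real"
  assumes "convex_on UNIV \<phi>"
  shows "\<bar>slope_seq \<phi> x e n\<bar> \<le> \<bar>slope_seq \<phi> x e 0\<bar> + \<bar>slope_seq \<phi> x (- e) 0\<bar>"
proof -
  have "slope_seq \<phi> x e n \<le> slope_seq \<phi> x e 0" "slope_seq \<phi> x (- e) n \<le> slope_seq \<phi> x (- e) 0"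
    by (auto intro!: decseqD[OF decseq_slope_seq[OF assms]] simp del: slope_seq_0)
  then show ?thesis using slope_seq_opposite[OF assms, of x e n] by linarith
qed

lemma convergent_slope_seq:
  fixes \<phi> :: "'a::real_vector \<Rightarrow> real"
  assumes "convex_on UNIV \<phi>"
  shows "convergent (slope_seq \<phi> x e)"
proof (rule Bseq_monoseq_convergent)
  show "Bseq (slope_seq \<phi> x e)" using abs_slope_seq_le[OF assms] by (intro BseqI') auto
  show "monoseq (slope_seq \<phi> x e)" using decseq_slope_seq[OF assms] by (rule decseq_imp_monoseq)
qed

lemma slope_seq_tendsto_derivative:
  fixes f :: "'a::real_normed_vector \<Rightarrow> real"
  assumes "(f has_derivative D) (at x)"
  shows "slope_seq f x e \<longlonglongrightarrow> D e"
proof -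
  interpret D: bounded_linear D using assms by (rule has_derivative_bounded_linear)
  have "((\<lambda>t. x + t *\<^sub>R e) has_derivative (\<lambda>t. t *\<^sub>R e)) (at (0::real))"
    by (auto intro!: derivative_eq_intros)
  then have "((\<lambda>t. f (x + t *\<^sub>R e)) has_derivative (\<lambda>t. D (t *\<^sub>R e))) (at 0)"
    by (rule has_derivative_compose[of _ _ _ _ f D]) (use assms in simp)
  moreover have "(\<lambda>t. D (t *\<^sub>R e)) = (*) (D e)" by (auto simp: D.scaleR fun_eq_iff)
  ultimately have "((\<lambda>t. f (x + t *\<^sub>R e)) has_real_derivative D e) (at 0)"
    by (simp add: has_field_derivative_def)
  then have "((\<lambda>t. (f (x + t *\<^sub>R e) - f x) / t) \<longlongrightarrow> D e) (at 0)"
    by (simp add: has_field_derivative_iff)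
  moreover have "filterlim (\<lambda>n. 1 / real (Suc n)) (at 0) sequentially"
    using LIMSEQ_inverse_real_of_nat by (auto simp: filterlim_at inverse_eq_divide)
  ultimately have "(\<lambda>n. (f (x + (1 / real (Suc n)) *\<^sub>R e) - f x) / (1 / real (Suc n))) \<longlonglongrightarrow> D e"
    by (rule filterlim_compose)
  moreover have "(\<lambda>n. (f (x + (1 / real (Suc n)) *\<^sub>R e) - f x) / (1 / real (Suc n))) = slope_seq f x e"
    by (intro ext) (simp add: slope_seq_def del: of_nat_Suc)
  ultimately show ?thesis by (simp only:)
qed

text \<open>
  A convex function with two-sided partial derivatives \<open>G \<bullet> i\<close> along an orthonormal basis has
  \<open>G\<close> as a subgradient. With \<open>u = y - x\<close>, the point \<open>x - \<epsilon> *\<^sub>R u\<close> is an average of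
  points that differ from \<open>x\<close> along one axis each, so the function there is at most
  \<open>\<phi> x - \<epsilon> * (G \<bullet> u) + o(\<epsilon>)\<close>; and \<open>x\<close> lies between \<open>x - \<epsilon> *\<^sub>R u\<close> and \<open>y\<close>, which
  turns this upper bound into a lower bound on \<open>\<phi> y\<close>.
\<close>
lemma subdiffI_limit_slope_seq:
  fixes \<phi> :: "'a::euclidean_space \<Rightarrow> real"
  assumes "convex_on UNIV \<phi>"
    and "\<And>i. i \<in> Basis \<Longrightarrow> slope_seq \<phi> x i \<longlonglongrightarrow> G \<bullet> i"
    and "\<And>i. i \<in> Basis \<Longrightarrow> slope_seq \<phi> x (- i) \<longlonglongrightarrow> - (G \<bullet> i)"
  shows "G \<in> subdiff \<phi> x"
  unfolding subdiff_def
proof (intro CollectI allI)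
  fix y
  define u where "u = y - x"
  define U where "U = (\<Sum>i\<in>Basis. \<bar>u \<bullet> i\<bar>)"
  have U: "0 \<le> U" by (auto simp: U_def sum_nonneg)
  have key: "\<phi> x + G \<bullet> u \<le> \<phi> y + \<eta> * U" if "\<eta> > 0" for \<eta>
  proof -
    have "\<forall>\<^sub>F n in sequentially. \<forall>i\<in>Basis. slope_seq \<phi> x i n < G \<bullet> i + \<eta> \<and>
            slope_seq \<phi> x (- i) n < - (G \<bullet> i) + \<eta>"
      using that by (intro eventually_ball_finite ballI eventually_conj order_tendstoD(2)[OF assms(2)]
          order_tendstoD(2)[OF assms(3)]) auto
    then obtain n where n: "\<And>i. i \<in> Basis \<Longrightarrow> slope_seq \<phi> x i n < G \<bullet> i + \<eta>"
      "\<And>i. i \<in> Basis \<Longrightarrow> slope_seq \<phi> x (- i) n < - (G \<bullet> i) + \<eta>"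
      by (auto simp: eventually_sequentially)
    have up: "\<phi> (x + t *\<^sub>R i) \<le> \<phi> x + t * (G \<bullet> i) + \<eta> * \<bar>t\<bar>"
      if "i \<in> Basis" "\<bar>t\<bar> \<le> 1 / real (Suc n)" for i t
    proof (cases "t \<ge> 0")
      case True
      then have "\<phi> (x + t *\<^sub>R i) \<le> \<phi> x + t * slope_seq \<phi> x i n"
        using that by (intro convex_le_slope_seq assms(1)) auto
      also have "\<dots> \<le> \<phi> x + t * (G \<bullet> i + \<eta>)"
        using n(1)[OF that(1)] True by (intro add_left_mono mult_left_mono) auto
      finally show ?thesis using True by (simp add: algebra_simps)
    next
      case False
      then have "\<phi> (x + (- t) *\<^sub>R (- i)) \<le> \<phi> x + (- t) * slope_seq \<phi> x (- i) n"
        using that by (intro convex_le_slope_seq assms(1)) auto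
      also have "\<dots> \<le> \<phi> x + (- t) * (- (G \<bullet> i) + \<eta>)"
        using n(2)[OF that(1)] False by (intro add_left_mono mult_left_mono) auto
      finally show ?thesis using False by (simp add: algebra_simps)
    qed
    define D where "D = real DIM('a)"
    have D: "D > 0" by (simp add: D_def)
    \<comment> \<open>So small that all axis-parallel displacements have length at most \<open>1 / (n + 1)\<close>.\<close>
    define \<epsilon> where "\<epsilon> = 1 / (real (Suc n) * D * (U + 1))"
    have \<epsilon>: "\<epsilon> > 0" using D U by (simp add: \<epsilon>_def)
    have small: "\<bar>- \<epsilon> * D * (u \<bullet> i)\<bar> \<le> 1 / real (Suc n)" if "i \<in> Basis" for i
    proof -
      have "\<bar>u \<bullet> i\<bar> \<le> U" unfolding U_def by (rule member_le_sum) (use that in auto)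
      then have "\<bar>u \<bullet> i\<bar> \<le> U + 1" by simp
      then have "\<epsilon> * D * \<bar>u \<bullet> i\<bar> \<le> \<epsilon> * D * (U + 1)" using \<epsilon> D by (intro mult_left_mono) auto
      also have "\<dots> = 1 / real (Suc n)" using D U by (simp add: \<epsilon>_def)
      finally show ?thesis using \<epsilon> D by (simp add: abs_mult)
    qed
    have "x - \<epsilon> *\<^sub>R u = (\<Sum>i\<in>Basis. (1 / D) *\<^sub>R (x + (- \<epsilon> * D * (u \<bullet> i)) *\<^sub>R i))"
    proof -
      have "(\<Sum>i\<in>Basis. (1 / D) *\<^sub>R (x + (- \<epsilon> * D * (u \<bullet> i)) *\<^sub>R i))
          = (\<Sum>i\<in>(Basis::'a set). (1 / D) *\<^sub>R x) + (\<Sum>i\<in>Basis. (- \<epsilon>) *\<^sub>R ((u \<bullet> i) *\<^sub>R i))"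
        using D by (simp add: scaleR_diff_right sum_subtractf sum_negf)
      also have "(\<Sum>i\<in>(Basis::'a set). (1 / D) *\<^sub>R x) = x"
        using D by (simp add: sum_constant_scaleR D_def)
      also have "(\<Sum>i\<in>Basis. (- \<epsilon>) *\<^sub>R ((u \<bullet> i) *\<^sub>R i)) = (- \<epsilon>) *\<^sub>R u"
        unfolding scaleR_sum_right[symmetric] euclidean_representation ..
      finally show ?thesis by simp
    qed
    then have "\<phi> (x - \<epsilon> *\<^sub>R u) \<le> (\<Sum>i\<in>Basis. (1 / D) * \<phi> (x + (- \<epsilon> * D * (u \<bullet> i)) *\<^sub>R i))"
      using convex_on_sum[OF finite_Basis _ assms(1), of "\<lambda>_. 1 / D" "\<lambda>i. x + (- \<epsilon> * D * (u \<bullet> i)) *\<^sub>R i"] D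
      by (simp add: D_def)
    also have "\<dots> \<le> (\<Sum>i\<in>(Basis::'a set). (1 / D) * (\<phi> x + (- \<epsilon> * D * (u \<bullet> i)) * (G \<bullet> i) + \<eta> * \<bar>- \<epsilon> * D * (u \<bullet> i)\<bar>))"
      using D by (intro sum_mono mult_left_mono up small) auto
    also have "\<dots> = (\<Sum>i\<in>(Basis::'a set). (1 / D) * \<phi> x + (- \<epsilon>) * ((G \<bullet> i) * (u \<bullet> i)) + (\<epsilon> * \<eta>) * \<bar>u \<bullet> i\<bar>)"
      using D \<epsilon> by (intro sum.cong) (auto simp: field_simps abs_mult)
    also have "\<dots> = \<phi> x - \<epsilon> * (G \<bullet> u) + \<epsilon> * \<eta> * U"
      using D by (simp add: sum.distrib U_def sum_distrib_left euclidean_inner[of G u] sum_negf sum_subtractf D_def)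
    finally have A: "\<phi> (x - \<epsilon> *\<^sub>R u) \<le> \<phi> x - \<epsilon> * (G \<bullet> u) + \<epsilon> * \<eta> * U" .
    define a where "a = \<epsilon> / (1 + \<epsilon>)"
    have a: "0 \<le> a" "a \<le> 1" "(1 + \<epsilon>) * (1 - a) = 1" "(1 + \<epsilon>) * a = \<epsilon>"
      using \<epsilon> by (auto simp: a_def field_simps)
    have "\<phi> ((1 - a) *\<^sub>R (x - \<epsilon> *\<^sub>R u) + a *\<^sub>R y) \<le> (1 - a) * \<phi> (x - \<epsilon> *\<^sub>R u) + a * \<phi> y"
      by (rule convex_onD[OF assms(1)]) (use a in auto)
    moreover have "(1 - a) *\<^sub>R (x - \<epsilon> *\<^sub>R u) + a *\<^sub>R y = x"
    proof -
      have y: "y = x + u" by (simp add: u_def)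
      have "(1 - a) *\<^sub>R (x - \<epsilon> *\<^sub>R u) + a *\<^sub>R y = x + (a - (1 - a) * \<epsilon>) *\<^sub>R u"
        unfolding y by (simp add: algebra_simps)
      also have "a - (1 - a) * \<epsilon> = 0" using \<epsilon> by (simp add: a_def field_simps)
      finally show ?thesis by simp
    qed
    ultimately have "\<phi> x \<le> (1 - a) * \<phi> (x - \<epsilon> *\<^sub>R u) + a * \<phi> y" by simp
    then have "(1 + \<epsilon>) * \<phi> x \<le> (1 + \<epsilon>) * ((1 - a) * \<phi> (x - \<epsilon> *\<^sub>R u) + a * \<phi> y)"
      using \<epsilon> by (intro mult_left_mono) auto
    also have "\<dots> = ((1 + \<epsilon>) * (1 - a)) * \<phi> (x - \<epsilon> *\<^sub>R u) + ((1 + \<epsilon>) * a) * \<phi> y"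
      by (simp only: distrib_left mult.assoc)
    finally have "(1 + \<epsilon>) * \<phi> x \<le> \<phi> (x - \<epsilon> *\<^sub>R u) + \<epsilon> * \<phi> y"
      unfolding a by simp
    then have "\<epsilon> * (\<phi> x + G \<bullet> u) \<le> \<epsilon> * (\<phi> y + \<eta> * U)"
      using A by (simp add: algebra_simps)
    then show ?thesis using \<epsilon> by simp
  qed
  have "\<phi> x + G \<bullet> u \<le> \<phi> y"
  proof (rule field_le_epsilon)
    fix e :: real assume "e > 0"
    then have "\<phi> x + G \<bullet> u \<le> \<phi> y + e / (U + 1) * U" using U by (intro key) auto
    also have "e / (U + 1) * U \<le> e" using \<open>e > 0\<close> U by (simp add: field_simps)
    finally show "\<phi> x + G \<bullet> u \<le> \<phi> y + e" by simp
  qed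
  then show "\<phi> x + G \<bullet> (y - x) \<le> \<phi> y" by (simp add: u_def)
qed

text \<open>
  The difference quotients of a convex function decrease to the directional derivative.
\<close>
lemma gradient_in_subdiff:
  fixes f :: "'a::real_inner \<Rightarrow> real"
  assumes "convex_on UNIV f" "(f has_derivative (\<lambda>u. h \<bullet> u)) (at x)"
  shows "h \<in> subdiff f x"
  unfolding subdiff_def
proof (intro CollectI allI)
  fix y
  have "h \<bullet> (y - x) \<le> slope_seq f x (y - x) 0"
    by (intro decseq_ge decseq_slope_seq slope_seq_tendsto_derivative[OF assms(2)] assms(1))
  then show "f x + h \<bullet> (y - x) \<le> f y" by simp
qed

lemma gradient_minimizer_nonneg:
  fixes f :: "'a::real_inner \<Rightarrow> real"
  assumes "(f has_derivative (\<lambda>u. h \<bullet> u)) (at x)" "convex X" "x \<in> X" "y \<in> X"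
    and "\<And>y. y \<in> X \<Longrightarrow> f x \<le> f y"
  shows "0 \<le> h \<bullet> (y - x)"
proof (rule LIMSEQ_le_const)
  show "slope_seq f x (y - x) \<longlonglongrightarrow> h \<bullet> (y - x)" by (rule slope_seq_tendsto_derivative[OF assms(1)])
  have "x + (1 / real (Suc n)) *\<^sub>R (y - x) \<in> X" for n
    using convexD_alt[OF assms(2,3,4), of "1 / real (Suc n)"] by (simp add: algebra_simps)
  then have "0 \<le> slope_seq f x (y - x) n" for n
    unfolding slope_seq_def by (intro mult_nonneg_nonneg) (auto simp: assms(5))
  then show "\<exists>N. \<forall>n\<ge>N. 0 \<le> slope_seq f x (y - x) n" by blast
qed

text \<open>
  If the mean function is differentiable at \<open>x\<close>, then almost every \<open>F _ z\<close> has partial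
  derivatives at \<open>x\<close>: the sum of the two opposite one-sided derivatives is nonnegative by
  convexity, and its mean is \<open>h \<bullet> e + h \<bullet> (- e) = 0\<close>. So the gradient is an almost surely unique
  subgradient, measurable as a limit of difference quotients, and its mean is \<open>h\<close> by dominated
  convergence.
\<close>
lemma mean_subgradient_selection:
  fixes F :: "'a::euclidean_space \<Rightarrow> 'b \<Rightarrow> real"
  assumes convex: "\<And>z. convex_on UNIV (\<lambda>x. F x z)"
    and int: "\<And>x. integrable M (F x)"
    and diff: "((\<lambda>x. \<integral>z. F x z \<partial>M) has_derivative (\<lambda>u. h \<bullet> u)) (at x)"
  obtains g where "integrable M g" "(\<integral>z. g z \<partial>M) = h"
    "AE z in M. g z \<in> subdiff (\<lambda>x. F x z) x"
proof -
  define q where "q e n z = slope_seq (\<lambda>x. F x z) x e n" for e n z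
  define L where "L e z = lim (\<lambda>n. q e n z)" for e z
  have qL: "(\<lambda>n. q e n z) \<longlonglongrightarrow> L e z" for e z
    using convergent_slope_seq[OF convex, of z x e] by (simp add: L_def q_def convergent_LIMSEQ_iff)
  have q_int: "integrable M (q e n)" for e n
    unfolding q_def slope_seq_def by (intro integrable_mult_right Bochner_Integration.integrable_diff int)
  have q_mean: "(\<integral>z. q e n z \<partial>M) = slope_seq (\<lambda>x. \<integral>z. F x z \<partial>M) x e n" for e n
    unfolding q_def slope_seq_def using int by simp
  have [measurable]: "L e \<in> borel_measurable M" for e
    using q_int by (intro borel_measurable_LIMSEQ_real[OF qL]) auto
  \<comment> \<open>The quotients decrease in \<open>n\<close> along \<open>e\<close> and along \<open>- e\<close>, so the first ones dominate.\<close>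
  define w where "w e z = \<bar>q e 0 z\<bar> + \<bar>q (- e) 0 z\<bar>" for e z
  have w: "integrable M (w e)" for e
    unfolding w_def by (intro Bochner_Integration.integrable_add integrable_abs q_int)
  have qw: "norm (q e n z) \<le> w e z" for e n z
    unfolding w_def q_def real_norm_def by (rule abs_slope_seq_le[OF convex])
  have L_int: "integrable M (L e)" for e
    by (rule integrable_dominated_convergence[where s="q e" and w="w e"])
       (use q_int w qw qL in auto)
  have "(\<lambda>n. \<integral>z. q e n z \<partial>M) \<longlonglongrightarrow> (\<integral>z. L e z \<partial>M)" for e
    by (rule integral_dominated_convergence[where w="w e"]) (use q_int w qw qL in auto)
  then have L_mean: "(\<integral>z. L e z \<partial>M) = h \<bullet> e" for e
    unfolding q_mean using slope_seq_tendsto_derivative[OF diff, of e] LIMSEQ_unique by blast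
  have "AE z in M. L e z + L (- e) z = 0" for e
  proof (subst integral_nonneg_eq_0_iff_AE[symmetric])
    show "AE z in M. 0 \<le> L e z + L (- e) z"
      by (intro AE_I2 LIMSEQ_le_const[OF tendsto_add[OF qL qL]])
         (auto simp: q_def slope_seq_opposite[OF convex])
  qed (auto simp: L_int L_mean)
  then have AE: "AE z in M. \<forall>i\<in>Basis. L i z + L (- i) z = 0"
    by (intro AE_finite_allI finite_Basis) auto
  define g where "g z = (\<Sum>i\<in>Basis. L i z *\<^sub>R i)" for z
  have gi: "g z \<bullet> i = L i z" if "i \<in> Basis" for z i
    using that by (simp add: g_def)
  show thesis
  proof (rule that)
    show "integrable M g" unfolding g_def by (intro Bochner_Integration.integrable_sum integrable_scaleR_left L_int)
    have "(\<integral>z. g z \<partial>M) = (\<Sum>i\<in>Basis. (h \<bullet> i) *\<^sub>R i)"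
      unfolding g_def by (subst Bochner_Integration.integral_sum) (auto simp: L_int L_mean)
    then show "(\<integral>z. g z \<partial>M) = h" by (simp add: euclidean_representation)
    show "AE z in M. g z \<in> subdiff (\<lambda>x. F x z) x"
      using AE
    proof (rule AE_mp, intro AE_I2 impI)
      fix z assume z: "\<forall>i\<in>Basis. L i z + L (- i) z = 0"
      show "g z \<in> subdiff (\<lambda>x. F x z) x"
      proof (rule subdiffI_limit_slope_seq[OF convex])
        fix i :: 'a assume i: "i \<in> Basis"
        show "slope_seq (\<lambda>x. F x z) x i \<longlonglongrightarrow> g z \<bullet> i"
          using qL[of i z] by (simp add: gi[OF i] q_def)
        have "L (- i) z = - (g z \<bullet> i)" using bspec[OF z i] by (simp add: gi[OF i])
        then show "slope_seq (\<lambda>x. F x z) x (- i) \<longlonglongrightarrow> - (g z \<bullet> i)"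
          using qL[of "- i" z] by (simp add: q_def)
      qed
    qed
  qed
qed

section \<open>Dual averaging with a distance-generating function\<close>

text \<open>
  The mean value theorem along the segment from \<open>x\<close> to \<open>u\<close>, applied to \<open>\<omega>\<close> minus the
  quadratic \<open>t\<^sup>2 / 2 * (nrm (u - x))\<^sup>2\<close>: by strong monotonicity of \<open>g\<close>, the derivative of the
  difference is at least \<open>g x \<bullet> (u - x)\<close>.
\<close>
lemma distance_generating_strongly_convex:
  fixes nrm :: "'a::euclidean_space \<Rightarrow> real"
  assumes "is_norm nrm" "distance_generating nrm \<omega>"
  obtains g where "g 0 = 0" "\<omega> 0 = 0" "continuous_on (nball nrm 0 1) \<omega>"
    "\<And>x u. x \<in> nball nrm 0 1 \<Longrightarrow> u \<in> nball nrm 0 1 \<Longrightarrow>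
       \<omega> x + g x \<bullet> (u - x) + (nrm (u - x))\<^sup>2 / 2 \<le> \<omega> u"
proof -
  let ?B = "nball nrm 0 1"
  obtain g where der: "\<And>x. x \<in> ?B \<Longrightarrow> (\<omega> has_derivative (\<lambda>h. g x \<bullet> h)) (at x within ?B)"
    and mono: "\<And>x y. x \<in> ?B \<Longrightarrow> y \<in> ?B \<Longrightarrow> (nrm (x - y))\<^sup>2 \<le> (g x - g y) \<bullet> (x - y)"
    and zero: "\<omega> 0 = 0" "g 0 = 0"
    using assms(2) unfolding distance_generating_def by auto
  have "\<omega> x + g x \<bullet> (u - x) + (nrm (u - x))\<^sup>2 / 2 \<le> \<omega> u" if x: "x \<in> ?B" and u: "u \<in> ?B" for x u
  proof -
    define d where "d = u - x"
    have seg: "x + t *\<^sub>R d \<in> ?B" if "t \<in> {0..1}" for t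
      using convexD_alt[OF convex_nball[OF assms(1)] x u, of t] that by (simp add: d_def algebra_simps)
    define \<psi> where "\<psi> t = \<omega> (x + t *\<^sub>R d) - t\<^sup>2 / 2 * (nrm d)\<^sup>2" for t :: real
    have "(\<psi> has_derivative (\<lambda>h. h * (g (x + t *\<^sub>R d) \<bullet> d - t * (nrm d)\<^sup>2))) (at t within {0..1})"
      if "t \<in> {0..1}" for t
    proof -
      have "((\<lambda>t. \<omega> (x + t *\<^sub>R d)) has_derivative (\<lambda>h. g (x + t *\<^sub>R d) \<bullet> (h *\<^sub>R d))) (at t within {0..1})"
      proof (rule has_derivative_in_compose[where f="\<lambda>t. x + t *\<^sub>R d"])
        show "((\<lambda>t. x + t *\<^sub>R d) has_derivative (\<lambda>h. h *\<^sub>R d)) (at t within {0..1})"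
          by (auto intro!: derivative_eq_intros)
        show "(\<omega> has_derivative (\<bullet>) (g (x + t *\<^sub>R d))) (at (x + t *\<^sub>R d) within (\<lambda>t. x + t *\<^sub>R d) ` {0..1})"
          using seg that by (intro has_derivative_subset[OF der]) auto
      qed
      then show ?thesis unfolding \<psi>_def
        by (auto intro!: derivative_eq_intros simp: fun_eq_iff algebra_simps)
    qed
    then obtain t where t: "t \<in> {0<..<1}" "\<psi> 1 - \<psi> 0 = (1 - 0) * (g (x + t *\<^sub>R d) \<bullet> d - t * (nrm d)\<^sup>2)"
      using mvt_simple[of 0 1 \<psi> "\<lambda>t h. h * (g (x + t *\<^sub>R d) \<bullet> d - t * (nrm d)\<^sup>2)"] by auto
    have "(nrm (t *\<^sub>R d))\<^sup>2 \<le> (g (x + t *\<^sub>R d) - g x) \<bullet> (t *\<^sub>R d)"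
      using mono[OF seg x, of t] t(1) by simp
    then have "t * (t * (nrm d)\<^sup>2) \<le> t * ((g (x + t *\<^sub>R d) - g x) \<bullet> d)"
      using t(1) by (simp add: is_norm_scaleR[OF assms(1)] power_mult_distrib power2_eq_square mult_ac)
    then have "t * (nrm d)\<^sup>2 \<le> (g (x + t *\<^sub>R d) - g x) \<bullet> d" using t(1) by simp
    then have "g x \<bullet> d \<le> \<psi> 1 - \<psi> 0" using t(2) by (simp add: inner_diff_left)
    then show ?thesis by (simp add: \<psi>_def d_def)
  qed
  moreover have "continuous_on ?B \<omega>" using der by (rule has_derivative_continuous_on)
  ultimately show thesis using that zero by blast
qed

text \<open>
  The prox-mapping of \<open>\<omega>\<close>, that is, the gradient of the convex conjugate of \<open>\<omega>\<close> restricted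
  to the unit ball.
\<close>
definition prox :: "('a::euclidean_space \<Rightarrow> real) \<Rightarrow> ('a \<Rightarrow> real) \<Rightarrow> 'a \<Rightarrow> 'a" where
  "prox nrm \<omega> z = (SOME v. v \<in> nball nrm 0 1 \<and> (\<forall>u\<in>nball nrm 0 1. z \<bullet> u - \<omega> u \<le> z \<bullet> v - \<omega> v))"

context
  fixes nrm :: "'a::euclidean_space \<Rightarrow> real" and \<omega> :: "'a \<Rightarrow> real"
  assumes nrm: "is_norm nrm" and dgf: "distance_generating nrm \<omega>"
begin

lemma prox_maximizes:
  shows prox_in_nball: "prox nrm \<omega> z \<in> nball nrm 0 1"
    and prox_max: "u \<in> nball nrm 0 1 \<Longrightarrow> z \<bullet> u - \<omega> u \<le> z \<bullet> prox nrm \<omega> z - \<omega> (prox nrm \<omega> z)"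
proof -
  obtain g where "continuous_on (nball nrm 0 1) \<omega>"
    using distance_generating_strongly_convex[OF nrm dgf] by blast
  then have "\<exists>v\<in>nball nrm 0 1. \<forall>u\<in>nball nrm 0 1. z \<bullet> u - \<omega> u \<le> z \<bullet> v - \<omega> v"
    using zero_in_nball[OF nrm] by (intro continuous_attains_sup compact_nball nrm continuous_intros) auto
  then have "\<exists>v. v \<in> nball nrm 0 1 \<and> (\<forall>u\<in>nball nrm 0 1. z \<bullet> u - \<omega> u \<le> z \<bullet> v - \<omega> v)"
    by blast
  from someI_ex[OF this]
  show "prox nrm \<omega> z \<in> nball nrm 0 1"
    "u \<in> nball nrm 0 1 \<Longrightarrow> z \<bullet> u - \<omega> u \<le> z \<bullet> prox nrm \<omega> z - \<omega> (prox nrm \<omega> z)"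
    unfolding prox_def by blast+
qed

text \<open>
  Strong convexity of \<open>\<omega>\<close> makes the objective at the maximizer exceed the objective at \<open>u\<close> by half
  the squared distance. The maximizer is compared with points \<open>w\<close> on the segment towards \<open>u\<close>; as \<open>w\<close> tends
  to the maximizer the full quadratic term is reached.
\<close>
lemma prox_quadratic_gap:
  assumes u: "u \<in> nball nrm 0 1"
  shows "z \<bullet> u - \<omega> u + (nrm (u - prox nrm \<omega> z))\<^sup>2 / 2 \<le> z \<bullet> prox nrm \<omega> z - \<omega> (prox nrm \<omega> z)"
proof -
  define v where "v = prox nrm \<omega> z"
  have v: "v \<in> nball nrm 0 1" unfolding v_def by (rule prox_in_nball)
  obtain g where sc: "\<And>x u. x \<in> nball nrm 0 1 \<Longrightarrow> u \<in> nball nrm 0 1 \<Longrightarrow>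
       \<omega> x + g x \<bullet> (u - x) + (nrm (u - x))\<^sup>2 / 2 \<le> \<omega> u"
    using distance_generating_strongly_convex[OF nrm dgf] by metis
  define n where "n = (nrm (u - v))\<^sup>2 / 2"
  define A where "A = (z \<bullet> v - \<omega> v) - (z \<bullet> u - \<omega> u)"
  have "a * n \<le> A" if a: "0 < a" "a < 1" for a
  proof -
    define t where "t = 1 - a"
    have t: "0 < t" "t < 1" using a by (auto simp: t_def)
    define w where "w = (1 - t) *\<^sub>R v + t *\<^sub>R u"
    have w: "w \<in> nball nrm 0 1"
      unfolding w_def using t by (intro convexD_alt convex_nball nrm u v) auto
    have wu: "u - w = (1 - t) *\<^sub>R (u - v)" and wv: "v - w = (- t) *\<^sub>R (u - v)"
      by (simp_all add: w_def algebra_simps)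
    have 1: "\<omega> w + (1 - t) * (g w \<bullet> (u - v)) + (1 - t)\<^sup>2 * n \<le> \<omega> u"
      using sc[OF w u] unfolding wu using t by (simp add: is_norm_scaleR[OF nrm] power_mult_distrib n_def)
    have 2: "\<omega> w - t * (g w \<bullet> (u - v)) + t\<^sup>2 * n \<le> \<omega> v"
      using sc[OF w v] unfolding wv by (simp add: is_norm_scaleR[OF nrm] power_mult_distrib n_def is_norm_minus[OF nrm])
    have "t * (\<omega> w + (1 - t) * (g w \<bullet> (u - v)) + (1 - t)\<^sup>2 * n) +
        (1 - t) * (\<omega> w - t * (g w \<bullet> (u - v)) + t\<^sup>2 * n) \<le> t * \<omega> u + (1 - t) * \<omega> v"
      using t by (intro add_mono mult_left_mono 1 2) auto
    moreover have "t * (\<omega> w + (1 - t) * (g w \<bullet> (u - v)) + (1 - t)\<^sup>2 * n) +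
        (1 - t) * (\<omega> w - t * (g w \<bullet> (u - v)) + t\<^sup>2 * n) = \<omega> w + t * (1 - t) * n"
      by (simp add: algebra_simps power2_eq_square)
    ultimately have 3: "\<omega> w + t * (1 - t) * n \<le> t * \<omega> u + (1 - t) * \<omega> v" by simp
    have "z \<bullet> w - \<omega> w \<le> z \<bullet> v - \<omega> v" unfolding v_def by (rule prox_max[OF w])
    moreover have "z \<bullet> w = (1 - t) * (z \<bullet> v) + t * (z \<bullet> u)" by (simp add: w_def inner_add_right)
    ultimately have "t * ((1 - t) * n) \<le> t * A" using 3 by (simp add: A_def algebra_simps)
    then show ?thesis using t by (simp add: t_def)
  qed
  then have "n \<le> A" by (rule field_le_mult_one_interval)
  then show ?thesis unfolding v_def[symmetric] by (simp add: n_def A_def)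
qed

text \<open>
  Adding the quadratic gaps at two points shows that the prox-mapping is Lipschitz.
\<close>
lemma prox_borel_measurable: "prox nrm \<omega> \<in> borel_measurable borel"
proof -
  obtain m where m: "m > 0" "\<And>x. m * norm x \<le> nrm x"
    using is_norm_ge_multiple_of_norm[OF nrm] by blast
  obtain C where C: "\<And>y. conj_norm nrm y \<le> C * norm y"
    using conj_norm_le_multiple_of_norm[OF nrm] by blast
  have "norm (prox nrm \<omega> z - prox nrm \<omega> z') \<le> \<bar>C\<bar> / m * norm (z - z')" for z z'
  proof -
    define v v' where "v = prox nrm \<omega> z" and "v' = prox nrm \<omega> z'"
    have sym: "nrm (v' - v) = nrm (v - v')" using is_norm_minus[OF nrm, of "v - v'"] by simp
    have "z \<bullet> v' - \<omega> v' + (nrm (v - v'))\<^sup>2 / 2 \<le> z \<bullet> v - \<omega> v"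
      using prox_quadratic_gap[OF prox_in_nball, of z z'] by (simp add: v_def[symmetric] v'_def[symmetric] sym)
    moreover have "z' \<bullet> v - \<omega> v + (nrm (v - v'))\<^sup>2 / 2 \<le> z' \<bullet> v' - \<omega> v'"
      using prox_quadratic_gap[OF prox_in_nball, of z' z] by (simp add: v_def[symmetric] v'_def[symmetric])
    ultimately have "(nrm (v - v'))\<^sup>2 \<le> (v - v') \<bullet> (z - z')"
      by (simp add: inner_diff_left inner_diff_right inner_commute)
    also have "\<dots> \<le> nrm (v - v') * conj_norm nrm (z - z')"
      by (rule inner_le_nrm_mult_conj_norm[OF nrm])
    finally have "nrm (v - v') * nrm (v - v') \<le> nrm (v - v') * conj_norm nrm (z - z')"
      by (simp add: power2_eq_square)
    then have "nrm (v - v') \<le> conj_norm nrm (z - z')"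
      using is_norm_nonneg[OF nrm, of "v - v'"] conj_norm_nonneg[OF nrm, of "z - z'"]
      by (cases "nrm (v - v') = 0") (auto simp: mult_le_cancel_left)
    also have "\<dots> \<le> \<bar>C\<bar> * norm (z - z')"
      by (rule order_trans[OF C]) (simp add: mult_right_mono)
    finally have "m * norm (v - v') \<le> \<bar>C\<bar> * norm (z - z')" using m(2)[of "v - v'"] by linarith
    then show ?thesis using m(1) by (simp add: v_def v'_def field_simps)
  qed
  then have "(\<bar>C\<bar> / m)-lipschitz_on UNIV (prox nrm \<omega>)"
    using m(1) by (intro lipschitz_onI) (auto simp: dist_norm)
  then show ?thesis by (intro borel_measurable_continuous_onI lipschitz_on_continuous_on)
qed

lemma Omega_const_bounds:
  shows Omega_const_pos: "0 < Omega_const nrm \<omega>"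
    and dgf_nonneg: "u \<in> nball nrm 0 1 \<Longrightarrow> 0 \<le> \<omega> u"
    and dgf_le_Omega: "u \<in> nball nrm 0 1 \<Longrightarrow> \<omega> u \<le> (Omega_const nrm \<omega>)\<^sup>2 / 2"
proof -
  obtain g where g: "g 0 = 0" "\<omega> 0 = 0" "continuous_on (nball nrm 0 1) \<omega>"
    and sc: "\<And>x u. x \<in> nball nrm 0 1 \<Longrightarrow> u \<in> nball nrm 0 1 \<Longrightarrow>
       \<omega> x + g x \<bullet> (u - x) + (nrm (u - x))\<^sup>2 / 2 \<le> \<omega> u"
    using distance_generating_strongly_convex[OF nrm dgf] by metis
  have low: "(nrm u)\<^sup>2 / 2 \<le> \<omega> u" if "u \<in> nball nrm 0 1" for u
    using sc[OF zero_in_nball[OF nrm] that] g by simp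
  then show nonneg: "0 \<le> \<omega> u" if "u \<in> nball nrm 0 1" for u
    using low[OF that] zero_le_power2[of "nrm u"] by linarith
  have "bdd_above ((\<lambda>x. sqrt (2 * \<omega> x)) ` nball nrm 0 1)"
    by (intro bounded_imp_bdd_above compact_imp_bounded compact_continuous_image compact_nball
        continuous_intros g nrm)
  then have up: "sqrt (2 * \<omega> u) \<le> Omega_const nrm \<omega>" if "u \<in> nball nrm 0 1" for u
    unfolding Omega_const_def using that by (intro cSUP_upper)
  show "\<omega> u \<le> (Omega_const nrm \<omega>)\<^sup>2 / 2" if "u \<in> nball nrm 0 1" for u
    using power_mono[OF up[OF that], of 2] nonneg[OF that] by simp
  obtain b :: 'a where b: "b \<in> Basis" using nonempty_Basis by blast
  have nb: "nrm b > 0" using is_norm_nonneg[OF nrm, of b] is_norm_eq_0[OF nrm, of b] nonzero_Basis[OF b] by force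
  define u where "u = (1 / nrm b) *\<^sub>R b"
  have nu: "nrm u = 1" using nb by (simp add: u_def is_norm_scaleR[OF nrm])
  then have u: "u \<in> nball nrm 0 1" by (simp add: nball_def)
  have "0 < sqrt (2 * \<omega> u)" using low[OF u] nu by simp
  then show "0 < Omega_const nrm \<omega>" using up[OF u] by linarith
qed

text \<open>
  The linear functional \<open>y \<mapsto> (\<Sum>t. \<Delta> t \<bullet> y)\<close> is compared with the sum over
  predictable points \<open>v t\<close>, each computed from \<open>\<Delta> 1, ..., \<Delta> (t - 1)\<close>. The potential is the convex
  conjugate \<open>W\<close> of \<open>\<omega>\<close> on the unit ball: by \<open>prox_quadratic_gap\<close> it is 1-smooth, so one
  step raises it by at most \<open>\<gamma> * (\<Delta> t \<bullet> v t) + \<gamma>\<^sup>2 / 2 * (a t)\<^sup>2\<close>, and at the end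
  it dominates \<open>\<gamma> * (\<Sum>t. \<Delta> t \<bullet> y) - \<omega> y\<close> for every \<open>y\<close> in the ball.
\<close>
lemma dual_averaging_regret:
  fixes \<Delta> :: "nat \<Rightarrow> 'a" and a :: "nat \<Rightarrow> real"
  assumes \<gamma>: "\<gamma> > 0" and a: "\<And>t u. t \<in> {1..n} \<Longrightarrow> u \<bullet> \<Delta> t \<le> nrm u * a t"
    and y: "y \<in> nball nrm 0 1"
  shows "(\<Sum>t\<in>{1..n}. \<Delta> t \<bullet> (y - prox nrm \<omega> (\<gamma> *\<^sub>R (\<Sum>s\<in>{1..<t}. \<Delta> s))))
           \<le> (Omega_const nrm \<omega>)\<^sup>2 / (2 * \<gamma>) + \<gamma> / 2 * (\<Sum>t\<in>{1..n}. (a t)\<^sup>2)"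
proof -
  define W where "W z = z \<bullet> prox nrm \<omega> z - \<omega> (prox nrm \<omega> z)" for z
  define v where "v t = prox nrm \<omega> (\<gamma> *\<^sub>R (\<Sum>s\<in>{1..<t}. \<Delta> s))" for t
  have step: "W (z + \<gamma> *\<^sub>R \<Delta> t) \<le> W z + \<gamma> * (\<Delta> t \<bullet> prox nrm \<omega> z) + \<gamma>\<^sup>2 / 2 * (a t)\<^sup>2"
    if "t \<in> {1..n}" for z t
  proof -
    define u where "u = prox nrm \<omega> (z + \<gamma> *\<^sub>R \<Delta> t)"
    define r where "r = nrm (u - prox nrm \<omega> z)"
    have "z \<bullet> u - \<omega> u + r\<^sup>2 / 2 \<le> W z"
      unfolding W_def r_def u_def by (rule prox_quadratic_gap[OF prox_in_nball])
    moreover have "(u - prox nrm \<omega> z) \<bullet> \<Delta> t \<le> r * a t" unfolding r_def by (rule a[OF that])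
    then have "\<gamma> * ((u - prox nrm \<omega> z) \<bullet> \<Delta> t) \<le> \<gamma> * (r * a t)" using \<gamma> by (intro mult_left_mono) auto
    moreover have "0 \<le> (r - \<gamma> * a t)\<^sup>2" by simp
    then have "\<gamma> * (r * a t) \<le> r\<^sup>2 / 2 + \<gamma>\<^sup>2 / 2 * (a t)\<^sup>2"
      by (simp add: power2_eq_square algebra_simps)
    moreover have "W (z + \<gamma> *\<^sub>R \<Delta> t) = z \<bullet> u - \<omega> u + \<gamma> * (\<Delta> t \<bullet> prox nrm \<omega> z) + \<gamma> * ((u - prox nrm \<omega> z) \<bullet> \<Delta> t)"
      by (simp add: W_def u_def[symmetric] inner_add_left inner_diff_left inner_commute algebra_simps)
    ultimately show ?thesis by linarith
  qed
  have "W (\<gamma> *\<^sub>R (\<Sum>s\<in>{1..<Suc k}. \<Delta> s)) \<le> (\<Sum>t\<in>{1..k}. \<gamma> * (\<Delta> t \<bullet> v t) + \<gamma>\<^sup>2 / 2 * (a t)\<^sup>2)" if "k \<le> n" for k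
    using that
  proof (induction k)
    case 0
    then show ?case using dgf_nonneg[OF prox_in_nball, of 0] by (simp add: W_def)
  next
    case (Suc k)
    have "W (\<gamma> *\<^sub>R (\<Sum>s\<in>{1..<Suc (Suc k)}. \<Delta> s)) = W (\<gamma> *\<^sub>R (\<Sum>s\<in>{1..<Suc k}. \<Delta> s) + \<gamma> *\<^sub>R \<Delta> (Suc k))"
      by (simp add: scaleR_add_right)
    also have "\<dots> \<le> W (\<gamma> *\<^sub>R (\<Sum>s\<in>{1..<Suc k}. \<Delta> s)) + \<gamma> * (\<Delta> (Suc k) \<bullet> v (Suc k)) + \<gamma>\<^sup>2 / 2 * (a (Suc k))\<^sup>2"
      unfolding v_def using Suc.prems by (intro step) auto
    also have "\<dots> \<le> (\<Sum>t\<in>{1..k}. \<gamma> * (\<Delta> t \<bullet> v t) + \<gamma>\<^sup>2 / 2 * (a t)\<^sup>2)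
        + \<gamma> * (\<Delta> (Suc k) \<bullet> v (Suc k)) + \<gamma>\<^sup>2 / 2 * (a (Suc k))\<^sup>2"
      using Suc by simp
    finally show ?case by simp
  qed
  from this[OF order_refl]
  have "W (\<gamma> *\<^sub>R (\<Sum>t\<in>{1..n}. \<Delta> t)) \<le> \<gamma> * (\<Sum>t\<in>{1..n}. \<Delta> t \<bullet> v t) + \<gamma>\<^sup>2 / 2 * (\<Sum>t\<in>{1..n}. (a t)\<^sup>2)"
    by (simp add: sum.distrib sum_distrib_left atLeastLessThanSuc_atLeastAtMost)
  moreover have "\<gamma> * (\<Sum>t\<in>{1..n}. \<Delta> t \<bullet> y) - \<omega> y \<le> W (\<gamma> *\<^sub>R (\<Sum>t\<in>{1..n}. \<Delta> t))"
    unfolding W_def using prox_max[OF y, of "\<gamma> *\<^sub>R (\<Sum>t\<in>{1..n}. \<Delta> t)"] by (simp add: inner_sum_left)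
  ultimately have "\<gamma> * ((\<Sum>t\<in>{1..n}. \<Delta> t \<bullet> y) - (\<Sum>t\<in>{1..n}. \<Delta> t \<bullet> v t))
      \<le> (Omega_const nrm \<omega>)\<^sup>2 / 2 + \<gamma>\<^sup>2 / 2 * (\<Sum>t\<in>{1..n}. (a t)\<^sup>2)"
    using dgf_le_Omega[OF y] by (simp add: algebra_simps)
  also have "\<dots> = \<gamma> * ((Omega_const nrm \<omega>)\<^sup>2 / (2 * \<gamma>) + \<gamma> / 2 * (\<Sum>t\<in>{1..n}. (a t)\<^sup>2))"
    using \<gamma> by (simp add: field_simps power2_eq_square)
  finally have "(\<Sum>t\<in>{1..n}. \<Delta> t \<bullet> y) - (\<Sum>t\<in>{1..n}. \<Delta> t \<bullet> v t)
      \<le> (Omega_const nrm \<omega>)\<^sup>2 / (2 * \<gamma>) + \<gamma> / 2 * (\<Sum>t\<in>{1..n}. (a t)\<^sup>2)"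
    using \<gamma> by (simp only: mult_le_cancel_left_pos)
  then show ?thesis by (simp add: v_def inner_diff_right sum_subtractf)
qed

end

section \<open>Sample average approximation\<close>

lemma closed_msupport: "closed (msupport P)"
  unfolding msupport_def by (intro closed_Inter) auto

text \<open>
  The complement of the support is a union of open null sets, and by the Lindelof property
  countably many of them suffice.
\<close>
lemma AE_in_msupport:
  fixes P :: "'b::second_countable_topology measure"
  assumes sets: "sets P = sets borel"
  shows "AE z in P. z \<in> msupport P"
proof -
  define \<F> where "\<F> = {U. open U \<and> emeasure P U = 0}"
  have "msupport P = - \<Union>\<F>"
  proof -
    have "{C. closed C \<and> emeasure P (- C) = 0} = uminus ` \<F>"
      by (force simp: \<F>_def image_iff closed_def intro: exI[of _ "- C" for C])
    then show ?thesis unfolding msupport_def by (auto simp: image_iff)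
  qed
  moreover obtain \<F>' where F: "\<F>' \<subseteq> \<F>" "countable \<F>'" "\<Union>\<F>' = \<Union>\<F>"
    using Lindelof[of \<F>] by (auto simp: \<F>_def)
  moreover have "\<Union>\<F>' \<in> null_sets P"
  proof -
    have "\<F>' \<subseteq> null_sets P" using F(1) sets by (auto simp: \<F>_def null_sets_def)
    then show ?thesis using null_sets_UN'[OF F(2), of "\<lambda>x. x" P] by auto
  qed
  ultimately show ?thesis by (intro AE_I'[of "\<Union>\<F>'"]) auto
qed

text \<open>
  By continuity in \<open>x\<close> the infimum over \<open>X\<close> may be taken over a countable dense subset.
\<close>
lemma Opt_SAA_measurable:
  fixes F :: "'a::euclidean_space \<Rightarrow> 'b \<Rightarrow> real"
  assumes conv: "\<And>z. convex_on UNIV (\<lambda>x. F x z)"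
    and meas: "\<And>x. F x \<in> borel_measurable P"
    and X: "X \<noteq> {}" "compact X"
  shows "Opt_SAA F X N \<in> borel_measurable (PiM {1..N} (\<lambda>_. P))"
proof -
  define \<phi> where "\<phi> z x = (1 / real N) * (\<Sum>t\<in>{1..N}. F x (z t))" for z x
  have cont: "continuous_on A (\<phi> z)" for A z
    unfolding \<phi>_def
    by (intro continuous_intros continuous_on_subset[OF convex_on_continuous[OF open_UNIV conv]]) auto
  obtain D where D: "countable D" "D \<subseteq> X" "X \<subseteq> closure D" using separable by blast
  have "bdd_below (\<phi> z ` X)" for z
    by (intro bounded_imp_bdd_below compact_imp_bounded compact_continuous_image cont X)
  then have ge: "c \<le> Opt_SAA F X N z \<longleftrightarrow> (\<forall>x\<in>D. c \<le> \<phi> z x)" for c z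
  proof -
    have "c \<le> Opt_SAA F X N z \<longleftrightarrow> (\<forall>x\<in>X. c \<le> \<phi> z x)"
      unfolding Opt_SAA_def \<phi>_def[symmetric] using X(1) \<open>bdd_below (\<phi> z ` X)\<close> by (intro le_cINF_iff)
    also have "\<dots> \<longleftrightarrow> (\<forall>x\<in>D. c \<le> \<phi> z x)"
      using D(2,3) continuous_ge_on_closure[of D "\<phi> z", OF cont] by blast
    finally show ?thesis .
  qed
  have [measurable]: "(\<lambda>z. \<phi> z x) \<in> borel_measurable (PiM {1..N} (\<lambda>_. P))" for x
  proof -
    have "(\<lambda>z. F x (z t)) \<in> borel_measurable (PiM {1..N} (\<lambda>_. P))" if "t \<in> {1..N}" for t
      by (rule measurable_compose[OF measurable_component_singleton[OF that] meas])
    then show ?thesis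
      unfolding \<phi>_def by (intro borel_measurable_times borel_measurable_const borel_measurable_sum)
  qed
  show ?thesis
    unfolding borel_measurable_iff_ge ge
    using D(1) by (intro allI sets.sets_Collect_countable_Ball) measurable
qed

text \<open>
  The case \<open>R = 0\<close> is included because a one-point feasible set has enclosing radius 0.
\<close>
lemma nball_scaled:
  assumes nrm: "is_norm nrm" and "x \<in> nball nrm c R" "0 \<le> R"
  obtains y where "y \<in> nball nrm 0 1" "x = c + R *\<^sub>R y"
proof (cases "R = 0")
  case True
  then have "nrm (x - c) \<le> 0" using assms(2) by (auto simp: nball_def)
  then have "x = c" using is_norm_nonneg[OF nrm, of "x - c"] is_norm_eq_0[OF nrm, of "x - c"] by simp
  then show thesis using that[of 0] zero_in_nball[OF nrm] True by simp
next
  case False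
  have "nrm (x - c) \<le> R" using assms(2) by (auto simp: nball_def)
  then have "(1 / R) *\<^sub>R (x - c) \<in> nball nrm 0 1"
    using False assms(3) is_norm_scaleR[OF nrm, of "1 / R" "x - c"] by (simp add: nball_def divide_le_eq)
  then show thesis using that[of "(1 / R) *\<^sub>R (x - c)"] False by simp
qed

text \<open>
  The sample-wise part of the upper confidence limit. By convexity, for every \<open>x\<close> in \<open>X\<close>
  the sum of the \<open>F x (z t)\<close> is at least the sum of the \<open>F x0 (z t)\<close> minus
  \<open>R * (\<Sum>t. \<Delta> t \<bullet> (y - y0))\<close>, where \<open>\<Delta> t = h - g (z t)\<close> and \<open>y\<close>, \<open>y0\<close> are the
  positions of \<open>x\<close>, \<open>x0\<close> in the unit ball. Inserting the predictable points \<open>v t\<close> splits this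
  sum into the regret, which is bounded for all \<open>y\<close> simultaneously by \<open>sq\<close>, and a martingale that
  does not depend on \<open>y\<close> and is bounded by \<open>mart\<close>.
\<close>
lemma SAA_lower_bound:
  fixes F :: "'a::euclidean_space \<Rightarrow> 'b \<Rightarrow> real"
  assumes nrm: "is_norm nrm" and dgf: "distance_generating nrm \<omega>"
    and X: "X \<noteq> {}" "X \<subseteq> nball nrm c R" "0 \<le> R" and x0: "x0 \<in> X"
    and opt: "\<And>x. x \<in> X \<Longrightarrow> 0 \<le> h \<bullet> (x - x0)"
    and sub: "\<And>t. t \<in> {1..N} \<Longrightarrow> g (z t) \<in> subdiff (\<lambda>x. F x (z t)) x0"
    and y0: "x0 = c + R *\<^sub>R y0"
    and "N > 0" "M > 0"
    and mean: "- (\<mu> * M1 * sqrt (real N)) \<le> (\<Sum>t\<in>{1..N}. F x0 (z t) - f0)"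
    and sq: "(\<Sum>t\<in>{1..N}. (conj_norm nrm (g (z t) - h))\<^sup>2) \<le> s\<^sup>2 * real N * M\<^sup>2"
    and mart: "(\<Sum>t\<in>{1..N}. (h - g (z t)) \<bullet> (prox nrm \<omega>
         ((Omega_const nrm \<omega> / (M * sqrt (real N))) *\<^sub>R (\<Sum>r\<in>{1..<t}. h - g (z r))) - y0)) \<le> 2 * l * M * sqrt (real N)"
  shows "f0 - (\<mu> * M1 + (Omega_const nrm \<omega> * (1 + s\<^sup>2) + 2 * l) * M * R) / sqrt (real N) \<le> Opt_SAA F X N z"
proof -
  define \<Omega> where "\<Omega> = Omega_const nrm \<omega>"
  have \<Omega>: "\<Omega> > 0" unfolding \<Omega>_def by (rule Omega_const_pos[OF nrm dgf])
  define n where "n = sqrt (real N)"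
  have n: "n > 0" "real N = n * n" using \<open>N > 0\<close> by (auto simp: n_def)
  \<comment> \<open>The step size that balances the two regret terms at \<open>s = 1\<close>.\<close>
  define \<gamma> where "\<gamma> = \<Omega> / (M * n)"
  have \<gamma>: "\<gamma> > 0" using \<Omega> n \<open>M > 0\<close> by (simp add: \<gamma>_def)
  define \<Delta> where "\<Delta> t = h - g (z t)" for t
  define v where "v t = prox nrm \<omega> (\<gamma> *\<^sub>R (\<Sum>r\<in>{1..<t}. \<Delta> r))" for t
  have mart': "(\<Sum>t\<in>{1..N}. \<Delta> t \<bullet> (v t - y0)) \<le> 2 * l * M * n"
    using mart by (simp only: v_def \<gamma>_def n_def \<Omega>_def \<Delta>_def)
  have key: "f0 - (\<mu> * M1 + (\<Omega> * (1 + s\<^sup>2) + 2 * l) * M * R) / n \<le> (1 / real N) * (\<Sum>t=1..N. F x (z t))"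
    if x: "x \<in> X" for x
  proof -
    obtain y where y: "y \<in> nball nrm 0 1" "x = c + R *\<^sub>R y"
      using nball_scaled[OF nrm _ X(3)] x X(2) by blast
    have dual: "u \<bullet> \<Delta> t \<le> nrm u * conj_norm nrm (g (z t) - h)" for u t
      using abs_inner_le_nrm_mult_conj_norm[OF nrm, of u "g (z t) - h"]
      by (simp add: \<Delta>_def inner_diff_right abs_le_iff)
    have "(\<Sum>t\<in>{1..N}. \<Delta> t \<bullet> (y - v t)) \<le> \<Omega>\<^sup>2 / (2 * \<gamma>) + \<gamma> / 2 * (\<Sum>t\<in>{1..N}. (conj_norm nrm (g (z t) - h))\<^sup>2)"
      unfolding v_def \<Omega>_def by (intro dual_averaging_regret nrm dgf \<gamma> dual y)
    also have "\<dots> \<le> \<Omega>\<^sup>2 / (2 * \<gamma>) + \<gamma> / 2 * (s\<^sup>2 * real N * M\<^sup>2)"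
      using \<gamma> sq by (intro add_left_mono mult_left_mono) auto
    also have "\<dots> = \<Omega> * (1 + s\<^sup>2) / 2 * M * n"
      using \<Omega> n \<open>M > 0\<close> by (simp add: \<gamma>_def field_simps power2_eq_square)
    \<comment> \<open>A factor 2 in front of the regret is given away here.\<close>
    also have "\<dots> \<le> \<Omega> * (1 + s\<^sup>2) * M * n"
      using \<Omega> n \<open>M > 0\<close> by (intro mult_right_mono) auto
    finally have reg: "(\<Sum>t\<in>{1..N}. \<Delta> t \<bullet> (y - v t)) \<le> \<Omega> * (1 + s\<^sup>2) * M * n" .
    have "(\<Sum>t\<in>{1..N}. \<Delta> t \<bullet> (y - y0)) = (\<Sum>t\<in>{1..N}. \<Delta> t \<bullet> (y - v t)) + (\<Sum>t\<in>{1..N}. \<Delta> t \<bullet> (v t - y0))"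
      by (simp add: inner_diff_right flip: sum.distrib)
    also have "\<dots> \<le> \<Omega> * (1 + s\<^sup>2) * M * n + 2 * l * M * n" by (intro add_mono reg mart')
    finally have "R * (\<Sum>t\<in>{1..N}. \<Delta> t \<bullet> (y - y0)) \<le> R * (\<Omega> * (1 + s\<^sup>2) * M * n + 2 * l * M * n)"
      using X(3) by (intro mult_left_mono)
    moreover have "R * (\<Sum>t\<in>{1..N}. \<Delta> t \<bullet> (y - y0)) = (\<Sum>t\<in>{1..N}. \<Delta> t \<bullet> (x - x0))"
      using y(2) y0 by (simp add: sum_distrib_left flip: scaleR_diff_right)
    moreover have "(\<Sum>t\<in>{1..N}. F x0 (z t) - \<Delta> t \<bullet> (x - x0)) \<le> (\<Sum>t\<in>{1..N}. F x (z t))"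
    proof (intro sum_mono)
      fix t assume "t \<in> {1..N}"
      then have "F x0 (z t) + g (z t) \<bullet> (x - x0) \<le> F x (z t)" using sub by (auto simp: subdiff_def)
      then show "F x0 (z t) - \<Delta> t \<bullet> (x - x0) \<le> F x (z t)"
        using opt[OF x] by (simp add: \<Delta>_def inner_diff_left)
    qed
    ultimately have "(n * n) * f0 - \<mu> * M1 * n - R * (\<Omega> * (1 + s\<^sup>2) * M * n + 2 * l * M * n)
        \<le> (\<Sum>t\<in>{1..N}. F x (z t))"
      using mean n by (simp add: sum_subtractf n_def[symmetric])
    then have "(1 / (n * n)) * ((n * n) * f0 - \<mu> * M1 * n - R * (\<Omega> * (1 + s\<^sup>2) * M * n + 2 * l * M * n))
        \<le> (1 / (n * n)) * (\<Sum>t\<in>{1..N}. F x (z t))"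
      using n by (intro mult_left_mono) auto
    moreover have "(1 / (n * n)) * ((n * n) * f0 - \<mu> * M1 * n - R * (\<Omega> * (1 + s\<^sup>2) * M * n + 2 * l * M * n))
        = f0 - (\<mu> * M1 + (\<Omega> * (1 + s\<^sup>2) + 2 * l) * M * R) / n"
      using n(1) by (simp add: field_simps)
    ultimately show ?thesis unfolding n(2) by simp
  qed
  show ?thesis
    unfolding Opt_SAA_def using X(1) key unfolding \<Omega>_def n_def by (intro cINF_greatest)
qed

text \<open>
  The minimum of the sample average is at most its value at \<open>x0\<close>.
\<close>
lemma SAA_upper_bound:
  fixes F :: "'a::euclidean_space \<Rightarrow> 'b \<Rightarrow> real"
  assumes conv: "\<And>z. convex_on UNIV (\<lambda>x. F x z)"
    and X: "compact X" and x0: "x0 \<in> X" and "N > 0"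
    and mean: "(\<Sum>t\<in>{1..N}. F x0 (z t) - f0) \<le> \<mu> * M1 * sqrt (real N)"
  shows "Opt_SAA F X N z \<le> f0 + \<mu> * M1 / sqrt (real N)"
proof -
  define n where "n = sqrt (real N)"
  have n: "n > 0" "real N = n * n" using \<open>N > 0\<close> by (auto simp: n_def)
  have "continuous_on X (\<lambda>x. (1 / real N) * (\<Sum>t\<in>{1..N}. F x (z t)))"
    by (intro continuous_intros continuous_on_subset[OF convex_on_continuous[OF open_UNIV conv]]) auto
  then have "bdd_below ((\<lambda>x. (1 / real N) * (\<Sum>t\<in>{1..N}. F x (z t))) ` X)"
    by (intro bounded_imp_bdd_below compact_imp_bounded compact_continuous_image X)
  then have "Opt_SAA F X N z \<le> (1 / real N) * (\<Sum>t\<in>{1..N}. F x0 (z t))"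
    unfolding Opt_SAA_def using x0 by (intro cINF_lower)
  also have "\<dots> \<le> (1 / real N) * (real N * f0 + \<mu> * M1 * n)"
    using mean by (intro mult_left_mono) (auto simp: sum_subtractf n_def)
  also have "\<dots> = f0 + \<mu> * M1 / n" using n by (simp add: field_simps)
  finally show ?thesis by (simp add: n_def)
qed

lemma real_has_derivative_inner:
  fixes f :: "'a::euclidean_space \<Rightarrow> real"
  assumes "f differentiable (at x)"
  obtains h where "(f has_derivative (\<lambda>u. h \<bullet> u)) (at x)"
proof -
  obtain D where D: "(f has_derivative D) (at x)" using assms by (auto simp: differentiable_def)
  have "D u = adjoint D 1 \<bullet> u" for u
    using adjoint_works[OF has_derivative_linear[OF D], of u 1] by (simp add: inner_commute)
  then have "D = (\<lambda>u. adjoint D 1 \<bullet> u)" by (rule ext)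
  then show thesis using D that by metis
qed

section \<open>Confidence bounds\<close>

text \<open>
  On the product space the exceptional set \<open>A\<close> is the union of four events, one for each term of the
  bound: large positive and large negative deviations of the sample average at \<open>x0\<close>, large
  \<open>\<Sum>t. (conj_norm nrm (g (z t) - h))\<^sup>2\<close>, and large \<open>\<Sum>t. \<Delta> t \<bullet> (v t - y0)\<close>. The last
  sum has martingale differences since \<open>\<Delta> t\<close> has mean 0 and \<open>v t\<close> is predictable; they are at most
  twice \<open>conj_norm nrm (g (z t) - h)\<close> as \<open>v t\<close> and \<open>y0\<close> lie in the unit ball.
\<close>
lemma SAA_confidence_product:
  fixes nrm :: "'a::euclidean_space \<Rightarrow> real" and F :: "'a \<Rightarrow> 'b \<Rightarrow> real" and P :: "'b measure"
  assumes f_def: "f = (\<lambda>x. \<integral>z. F x z \<partial>P)"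
    and nrm: "is_norm nrm" and dgf: "distance_generating nrm \<omega>"
    and X: "X \<noteq> {}" "convex X" "compact X" and P: "prob_space P"
    and conv: "\<And>z. convex_on UNIV (\<lambda>x. F x z)" and int: "\<And>x. integrable P (F x)"
    and x0: "x0 \<in> X" "\<And>x. x \<in> X \<Longrightarrow> f x0 \<le> f x"
    and h: "(f has_derivative (\<lambda>u. h \<bullet> u)) (at x0)"
    and L: "\<And>z g. z \<in> S \<Longrightarrow> g \<in> subdiff (\<lambda>x. F x z) x0 \<Longrightarrow> conj_norm nrm (g - h) \<le> L z"
    and S: "AE z in P. z \<in> S"
    and "M1 > 0" "M2 > 0"
    and m1: "(\<integral>\<^sup>+z. ennreal (exp ((F x0 z - f x0)\<^sup>2 / M1\<^sup>2)) \<partial>P) \<le> ennreal (exp 1)"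
    and m2: "(\<integral>\<^sup>+z. ennreal (exp ((L z)\<^sup>2 / M2\<^sup>2)) * indicator S z \<partial>P) \<le> ennreal (exp 1)"
    and "N > 0" "0 \<le> \<mu>1" "0 \<le> \<mu>2" "0 \<le> l"
  shows "\<exists>A\<in>sets (PiM {1..N} (\<lambda>_. P)).
    measure (PiM {1..N} (\<lambda>_. P)) A \<le> exp (- (\<mu>1\<^sup>2 / (4 * tau_star))) + exp (- (\<mu>2\<^sup>2 / (4 * tau_star))) +
        exp (- (real N * (s\<^sup>2 - 1))) + exp (- (l\<^sup>2 / (4 * tau_star))) \<and>
    (AE z in PiM {1..N} (\<lambda>_. P). z \<notin> A \<longrightarrow>
       Opt_SAA F X N z \<in> {f x0 - (\<mu>2 * M1 + (Omega_const nrm \<omega> * (1 + s\<^sup>2) + 2 * l) * M2 * min_radius nrm X) / sqrt (real N)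
         .. f x0 + \<mu>1 * M1 / sqrt (real N)})"
proof -
  interpret P: prob_space P by fact
  let ?Q = "PiM {1..N} (\<lambda>_::nat. P)"
  interpret Q: prob_space ?Q by (intro prob_space_PiM P)
  define R where "R = min_radius nrm X"
  obtain c where c: "X \<subseteq> nball nrm c R" "0 \<le> R"
    unfolding R_def using min_radius_attained[OF nrm X(3,1)] by blast
  obtain y0 where y0: "y0 \<in> nball nrm 0 1" "x0 = c + R *\<^sub>R y0"
    using nball_scaled[OF nrm _ c(2)] x0(1) c(1) by blast
  obtain g where g: "integrable P g" "(\<integral>z. g z \<partial>P) = h" "AE z in P. g z \<in> subdiff (\<lambda>x. F x z) x0"
    using mean_subgradient_selection[OF conv int h[unfolded f_def]] by blast
  have [measurable]: "g \<in> borel_measurable P" "F x \<in> borel_measurable P" for x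
    using g(1) int by auto
  note [measurable] = measurable_compose[OF _ conj_norm_borel_measurable[OF nrm]]
    measurable_compose[OF _ prox_borel_measurable[OF nrm dgf]]
  define \<gamma> where "\<gamma> = Omega_const nrm \<omega> / (M2 * sqrt (real N))"
  define v where "v t w = prox nrm \<omega> (\<gamma> *\<^sub>R (\<Sum>r\<in>{1..<t}. h - g (w r)))" for t and w :: "nat \<Rightarrow> 'b"
  define Y1 where "Y1 = (\<lambda>(t::nat) w. (F x0 (w t) - f x0) / M1)"
  define Y2 where "Y2 = (\<lambda>(t::nat) w. - ((F x0 (w t) - f x0) / M1))"
  define Y3 where "Y3 = (\<lambda>(t::nat) w. (conj_norm nrm (g (w t) - h))\<^sup>2 / M2\<^sup>2)"
  define Y4 where "Y4 = (\<lambda>(t::nat) w. (h - g (w t)) \<bullet> (v t w - y0) / (2 * M2))"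
  let ?bad = "\<lambda>Y b. {w \<in> space ?Q. b < (\<Sum>t\<in>{1..N}. Y t w)}"
  have comp: "(\<lambda>w. w t) \<in> measurable (PiM {1..n} (\<lambda>_. P)) P" if "t \<in> {1..n}" for t n :: nat
    using that by (rule measurable_component_singleton)
  have meas: "Y1 t \<in> borel_measurable (PiM {1..n} (\<lambda>_. P))" "Y2 t \<in> borel_measurable (PiM {1..n} (\<lambda>_. P))"
    "Y3 t \<in> borel_measurable (PiM {1..n} (\<lambda>_. P))" "Y4 t \<in> borel_measurable (PiM {1..n} (\<lambda>_. P))"
    if t: "t \<in> {1..n}" for t n :: nat
  proof -
    note [measurable] = comp[OF t]
    show "Y1 t \<in> borel_measurable (PiM {1..n} (\<lambda>_. P))" "Y2 t \<in> borel_measurable (PiM {1..n} (\<lambda>_. P))"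
      "Y3 t \<in> borel_measurable (PiM {1..n} (\<lambda>_. P))"
      unfolding Y1_def Y2_def Y3_def by measurable
    have [measurable]: "(\<lambda>w. \<Sum>r\<in>{1..<t}. h - g (w r)) \<in> borel_measurable (PiM {1..n} (\<lambda>_. P))"
    proof (intro borel_measurable_sum)
      fix r assume "r \<in> {1..<t}"
      then have [measurable]: "(\<lambda>w. w r) \<in> measurable (PiM {1..n} (\<lambda>_. P)) P" using t by (intro comp) auto
      show "(\<lambda>w. h - g (w r)) \<in> borel_measurable (PiM {1..n} (\<lambda>_. P))" by measurable
    qed
    show "Y4 t \<in> borel_measurable (PiM {1..n} (\<lambda>_. P))" unfolding Y4_def v_def by measurable
  qed
  have v_upd [simp]: "v t (w(t := y)) = v t w" for t w y
    unfolding v_def by (intro arg_cong[where f="prox nrm \<omega>"] arg_cong[where f="scaleR \<gamma>"] sum.cong) auto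
  have v_dep: "v t w = v t w'" if "\<forall>s\<in>{1..t}. w s = w' s" for t w w'
    unfolding v_def using that
    by (intro arg_cong[where f="prox nrm \<omega>"] arg_cong[where f="scaleR \<gamma>"] sum.cong) auto
  have dep: "Y1 t w = Y1 t w'" "Y2 t w = Y2 t w'" "Y3 t w = Y3 t w'" "Y4 t w = Y4 t w'"
    if "t \<ge> 1" "\<forall>s\<in>{1..t}. w s = w' s" for t w w'
  proof -
    have "w t = w' t" using that by auto
    then show "Y1 t w = Y1 t w'" "Y2 t w = Y2 t w'" "Y3 t w = Y3 t w'" "Y4 t w = Y4 t w'"
      using v_dep[OF that(2)] by (simp_all add: Y1_def Y2_def Y3_def Y4_def)
  qed
  have conj: "(\<integral>\<^sup>+y. ennreal (exp ((conj_norm nrm (g y - h))\<^sup>2 / M2\<^sup>2)) \<partial>P) \<le> ennreal (exp 1)"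
  proof (rule order_trans[OF nn_integral_mono_AE m2])
    show "AE y in P. ennreal (exp ((conj_norm nrm (g y - h))\<^sup>2 / M2\<^sup>2)) \<le> ennreal (exp ((L y)\<^sup>2 / M2\<^sup>2)) * indicator S y"
      using S g(3)
    proof eventually_elim
      case (elim y)
      then have "(conj_norm nrm (g y - h))\<^sup>2 \<le> (L y)\<^sup>2"
        by (intro power_mono L conj_norm_nonneg nrm)
      then show ?case using elim by (simp add: ennreal_leI divide_right_mono)
    qed
  qed
  have p1: "measure ?Q (?bad Y1 (\<mu>1 * sqrt (real N))) \<le> exp (- (\<mu>1\<^sup>2 / (4 * tau_star)))"
  proof (rule adapted_mean_zero_tail_bound[OF P meas(1) dep(1)])
    show "integrable P (\<lambda>y. Y1 t (w(t := y)))" for t w by (simp add: Y1_def int)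
    show "(\<integral>y. Y1 t (w(t := y)) \<partial>P) = 0" for t w by (simp add: Y1_def int f_def P.prob_space)
    show "(\<integral>\<^sup>+y. ennreal (exp ((Y1 t (w(t := y)))\<^sup>2)) \<partial>P) \<le> ennreal (exp 1)" for t w
      using m1 by (simp add: Y1_def power_divide)
  qed (assumption | fact)+
  have p2: "measure ?Q (?bad Y2 (\<mu>2 * sqrt (real N))) \<le> exp (- (\<mu>2\<^sup>2 / (4 * tau_star)))"
  proof (rule adapted_mean_zero_tail_bound[OF P meas(2) dep(2)])
    show "integrable P (\<lambda>y. Y2 t (w(t := y)))" for t w by (simp add: Y2_def int)
    show "(\<integral>y. Y2 t (w(t := y)) \<partial>P) = 0" for t w by (simp add: Y2_def int f_def P.prob_space)
    show "(\<integral>\<^sup>+y. ennreal (exp ((Y2 t (w(t := y)))\<^sup>2)) \<partial>P) \<le> ennreal (exp 1)" for t w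
      using m1 by (simp add: Y2_def power_divide)
  qed (assumption | fact)+
  have "measure ?Q (?bad Y3 (real N * s\<^sup>2)) \<le> exp (real N * 1 - 1 * (real N * s\<^sup>2))"
  proof (rule adapted_sum_tail_bound[OF P meas(3) dep(3)])
    show "(\<integral>\<^sup>+y. ennreal (exp (1 * Y3 t (w(t := y)))) \<partial>P) \<le> ennreal (exp 1)" for t w
      using conj by (simp add: Y3_def)
  qed (assumption | simp)+
  then have p3: "measure ?Q (?bad Y3 (real N * s\<^sup>2)) \<le> exp (- (real N * (s\<^sup>2 - 1)))"
    by (simp add: algebra_simps)
  have p4: "measure ?Q (?bad Y4 (l * sqrt (real N))) \<le> exp (- (l\<^sup>2 / (4 * tau_star)))"
  proof (rule adapted_mean_zero_tail_bound[OF P meas(4) dep(4)])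
    show "integrable P (\<lambda>y. Y4 t (w(t := y)))" for t w
      using g(1) by (simp add: Y4_def)
    show "(\<integral>y. Y4 t (w(t := y)) \<partial>P) = 0" for t w
      using g(1,2) by (simp add: Y4_def P.prob_space)
    show "(\<integral>\<^sup>+y. ennreal (exp ((Y4 t (w(t := y)))\<^sup>2)) \<partial>P) \<le> ennreal (exp 1)" for t w
    proof (rule order_trans[OF nn_integral_mono conj], rule ennreal_leI)
      fix y
      have "nrm (v t w - y0) \<le> 2"
        using is_norm_triangle_diff[OF nrm, of "v t w" y0] y0(1)
          prox_in_nball[OF nrm dgf, of "\<gamma> *\<^sub>R (\<Sum>r\<in>{1..<t}. h - g (w r))"]
        unfolding v_def by (simp add: nball_def)
      then have "\<bar>(v t w - y0) \<bullet> (g y - h)\<bar> \<le> 2 * conj_norm nrm (g y - h)"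
        by (intro order_trans[OF abs_inner_le_nrm_mult_conj_norm[OF nrm]] mult_right_mono conj_norm_nonneg nrm)
      moreover have "\<bar>(h - g y) \<bullet> (v t w - y0)\<bar> = \<bar>(v t w - y0) \<bullet> (g y - h)\<bar>"
        by (metis abs_minus_commute inner_commute inner_diff_right)
      ultimately have abs_le: "\<bar>(h - g y) \<bullet> (v t w - y0) / (2 * M2)\<bar> \<le> conj_norm nrm (g y - h) / M2"
        using \<open>M2 > 0\<close> by (simp add: abs_mult field_simps)
      have "((h - g y) \<bullet> (v t w - y0) / (2 * M2))\<^sup>2 \<le> (conj_norm nrm (g y - h) / M2)\<^sup>2"
        using power_mono[OF abs_le abs_ge_zero, of 2] by (simp only: power2_abs)
      then show "exp ((Y4 t (w(t := y)))\<^sup>2) \<le> exp ((conj_norm nrm (g y - h))\<^sup>2 / M2\<^sup>2)"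
        by (simp add: Y4_def power_divide)
    qed
  qed (assumption | fact)+
  define A1 A2 A3 A4 where "A1 = ?bad Y1 (\<mu>1 * sqrt (real N))" and "A2 = ?bad Y2 (\<mu>2 * sqrt (real N))"
    and "A3 = ?bad Y3 (real N * s\<^sup>2)" and "A4 = ?bad Y4 (l * sqrt (real N))"
  have [measurable]: "(\<lambda>w. \<Sum>t\<in>{1..N}. Y1 t w) \<in> borel_measurable ?Q" "(\<lambda>w. \<Sum>t\<in>{1..N}. Y2 t w) \<in> borel_measurable ?Q"
    "(\<lambda>w. \<Sum>t\<in>{1..N}. Y3 t w) \<in> borel_measurable ?Q" "(\<lambda>w. \<Sum>t\<in>{1..N}. Y4 t w) \<in> borel_measurable ?Q"
    by (intro borel_measurable_sum meas; assumption)+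
  have A: "A1 \<in> sets ?Q" "A2 \<in> sets ?Q" "A3 \<in> sets ?Q" "A4 \<in> sets ?Q"
    unfolding A1_def A2_def A3_def A4_def by measurable
  show ?thesis
  proof (intro bexI[of _ "A1 \<union> A2 \<union> A3 \<union> A4"] conjI)
    show "A1 \<union> A2 \<union> A3 \<union> A4 \<in> sets ?Q" using A by auto
    have "measure ?Q (A1 \<union> A2 \<union> A3 \<union> A4) \<le> measure ?Q A1 + measure ?Q A2 + measure ?Q A3 + measure ?Q A4"
      using A measure_Un_le[of "A1 \<union> A2 \<union> A3" ?Q A4] measure_Un_le[of "A1 \<union> A2" ?Q A3] measure_Un_le[of A1 ?Q A2]
      by (simp add: sets.Un)
    then show "measure ?Q (A1 \<union> A2 \<union> A3 \<union> A4) \<le> exp (- (\<mu>1\<^sup>2 / (4 * tau_star))) + exp (- (\<mu>2\<^sup>2 / (4 * tau_star))) +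
        exp (- (real N * (s\<^sup>2 - 1))) + exp (- (l\<^sup>2 / (4 * tau_star)))"
      using p1 p2 p3 p4 unfolding A1_def A2_def A3_def A4_def by linarith
    have "AE z in ?Q. \<forall>t\<in>{1..N}. g (z t) \<in> subdiff (\<lambda>x. F x (z t)) x0"
      by (intro AE_finite_allI AE_PiM_component[OF P _ g(3)]) auto
    moreover have "AE z in ?Q. z \<in> space ?Q" by (rule AE_space)
    ultimately show "AE z in ?Q. z \<notin> A1 \<union> A2 \<union> A3 \<union> A4 \<longrightarrow>
       Opt_SAA F X N z \<in> {f x0 - (\<mu>2 * M1 + (Omega_const nrm \<omega> * (1 + s\<^sup>2) + 2 * l) * M2 * min_radius nrm X) / sqrt (real N)
         .. f x0 + \<mu>1 * M1 / sqrt (real N)}"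
    proof (eventually_elim, intro impI)
      fix z
      assume sub: "\<forall>t\<in>{1..N}. g (z t) \<in> subdiff (\<lambda>x. F x (z t)) x0" and z: "z \<in> space ?Q"
        and "z \<notin> A1 \<union> A2 \<union> A3 \<union> A4"
      have b1: "(\<Sum>t\<in>{1..N}. Y1 t z) \<le> \<mu>1 * sqrt (real N)" and b2: "(\<Sum>t\<in>{1..N}. Y2 t z) \<le> \<mu>2 * sqrt (real N)"
        and b3: "(\<Sum>t\<in>{1..N}. Y3 t z) \<le> real N * s\<^sup>2" and b4: "(\<Sum>t\<in>{1..N}. Y4 t z) \<le> l * sqrt (real N)"
        using z \<open>z \<notin> A1 \<union> A2 \<union> A3 \<union> A4\<close> unfolding A1_def A2_def A3_def A4_def by auto
      have "(\<Sum>t\<in>{1..N}. F x0 (z t) - f x0) = M1 * (\<Sum>t\<in>{1..N}. Y1 t z)"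
        using \<open>M1 > 0\<close> by (simp add: Y1_def sum_distrib_left)
      also have "\<dots> \<le> M1 * (\<mu>1 * sqrt (real N))" using b1 \<open>M1 > 0\<close> by (intro mult_left_mono) auto
      finally have up: "(\<Sum>t\<in>{1..N}. F x0 (z t) - f x0) \<le> \<mu>1 * M1 * sqrt (real N)" by (simp add: mult_ac)
      have "- (\<Sum>t\<in>{1..N}. F x0 (z t) - f x0) = M1 * (\<Sum>t\<in>{1..N}. Y2 t z)"
        using \<open>M1 > 0\<close> by (simp add: Y2_def sum_distrib_left flip: sum_negf)
      also have "\<dots> \<le> M1 * (\<mu>2 * sqrt (real N))" using b2 \<open>M1 > 0\<close> by (intro mult_left_mono) auto
      finally have low: "- (\<mu>2 * M1 * sqrt (real N)) \<le> (\<Sum>t\<in>{1..N}. F x0 (z t) - f x0)" by (simp add: mult_ac)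
      have "(\<Sum>t\<in>{1..N}. (conj_norm nrm (g (z t) - h))\<^sup>2) = M2\<^sup>2 * (\<Sum>t\<in>{1..N}. Y3 t z)"
        using \<open>M2 > 0\<close> by (simp add: Y3_def sum_distrib_left)
      also have "\<dots> \<le> M2\<^sup>2 * (real N * s\<^sup>2)" using b3 by (intro mult_left_mono) auto
      finally have sq: "(\<Sum>t\<in>{1..N}. (conj_norm nrm (g (z t) - h))\<^sup>2) \<le> s\<^sup>2 * real N * M2\<^sup>2" by (simp add: mult_ac)
      have "(\<Sum>t\<in>{1..N}. (h - g (z t)) \<bullet> (v t z - y0)) = 2 * M2 * (\<Sum>t\<in>{1..N}. Y4 t z)"
        using \<open>M2 > 0\<close> by (simp add: Y4_def sum_distrib_left)
      also have "\<dots> \<le> 2 * M2 * (l * sqrt (real N))" using b4 \<open>M2 > 0\<close> by (intro mult_left_mono) auto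
      finally have mart: "(\<Sum>t\<in>{1..N}. (h - g (z t)) \<bullet> (v t z - y0)) \<le> 2 * l * M2 * sqrt (real N)" by (simp add: mult_ac)
      have opt: "0 \<le> h \<bullet> (x - x0)" if "x \<in> X" for x
        by (rule gradient_minimizer_nonneg[OF h X(2) x0(1) that x0(2)])
      have "f x0 - (\<mu>2 * M1 + (Omega_const nrm \<omega> * (1 + s\<^sup>2) + 2 * l) * M2 * R) / sqrt (real N) \<le> Opt_SAA F X N z"
        by (rule SAA_lower_bound[where F=F and g=g and h=h and z=z,
              OF nrm dgf X(1) c x0(1) opt _ y0(2) \<open>N > 0\<close> \<open>M2 > 0\<close> low sq
              mart[unfolded v_def \<gamma>_def]]) (use sub in auto)
      moreover have "Opt_SAA F X N z \<le> f x0 + \<mu>1 * M1 / sqrt (real N)"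
        by (rule SAA_upper_bound[where F=F and z=z, OF conv X(3) x0(1) \<open>N > 0\<close> up])
      ultimately show "Opt_SAA F X N z \<in> {f x0 - (\<mu>2 * M1 + (Omega_const nrm \<omega> * (1 + s\<^sup>2) + 2 * l) * M2 * min_radius nrm X) / sqrt (real N)
         .. f x0 + \<mu>1 * M1 / sqrt (real N)}" by (simp add: R_def)
    qed
  qed
qed

theorem corollary1:
  fixes nrm :: "'a::euclidean_space \<Rightarrow> real"
    and \<omega> :: "'a \<Rightarrow> real"
    and X :: "'a set"
    and P :: "(real ^ 'k) measure"
    and F :: "'a \<Rightarrow> real ^ 'k \<Rightarrow> real"
    and Pr :: "'w measure"
    and \<xi> :: "nat \<Rightarrow> 'w \<Rightarrow> real ^ 'k"
    and M1 M2 s l \<mu>1 \<mu>2 :: real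
    and N :: nat
  assumes "is_norm nrm"
    and "distance_generating nrm \<omega>"
    and "X \<noteq> {}" "convex X" "compact X"
    and "prob_space P" "sets P = sets borel"
    and "(\<lambda>(x, z). F x z) \<in> borel_measurable (restrict_space borel (UNIV \<times> msupport P))"
    and "\<forall>z\<in>msupport P. convex_on UNIV (\<lambda>x. F x z)"
    and "\<forall>x. set_integrable P (msupport P) (F x)"
    and "prob_space Pr"
    and "prob_space.indep_vars Pr (\<lambda>_. borel) \<xi> {1..}"
    and "\<forall>t\<ge>1. distr Pr borel (\<xi> t) = P"
    and "\<forall>x\<in>X. mean_fun P F differentiable (at x)"
    and "M1 > 0" "M2 > 0"
    and "\<forall>x\<in>X. (\<integral>\<^sup>+z\<in>msupport P. ennreal (exp ((F x z - mean_fun P F x)\<^sup>2 / M1\<^sup>2)) \<partial>P)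
                  \<le> ennreal (exp 1)"
    and "\<forall>x\<in>X. (\<integral>\<^sup>+z\<in>msupport P. ennreal (exp ((subgrad_dev nrm P F x z)\<^sup>2 / M2\<^sup>2)) \<partial>P)
                  \<le> ennreal (exp 1)"
    and "N > 0" "s > 1" "l \<ge> 0"
    and "\<mu>1 \<in> {0..2 * sqrt (tau_star * real N)}"
    and "\<mu>2 \<in> {0..2 * sqrt (tau_star * real N)}"
  shows "measure Pr {w \<in> space Pr. (\<forall>t\<in>{1..N}. \<xi> t w \<in> msupport P) \<and>
             Opt P F X \<in> {Low F X M1 \<mu>1 N (\<lambda>t. \<xi> t w)..Up nrm \<omega> F X M1 M2 \<mu>2 s l N (\<lambda>t. \<xi> t w)}}
         \<ge> 1 - (exp (- (\<mu>1\<^sup>2 / (4 * tau_star))) + exp (- (\<mu>2\<^sup>2 / (4 * tau_star))) +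
                 exp (- (real N * (s\<^sup>2 - 1))) + exp (- (l\<^sup>2 / (4 * tau_star))))"
proof -
  note nrm = assms(1) and dgf = assms(2) and X = assms(3,4,5) and P = assms(6) and sets_P = assms(7)
  interpret P: prob_space P by (rule P)
  interpret Pr: prob_space Pr by (rule assms(11))
  define S where "S = msupport P"
  have S_borel: "S \<in> sets P" unfolding S_def sets_P by (intro borel_closed closed_msupport)
  have S_AE: "AE z in P. z \<in> S" unfolding S_def by (rule AE_in_msupport[OF sets_P])
  \<comment> \<open>Setting \<open>F\<close> to 0 off the support gives an integrand that is convex and measurable everywhere.\<close>
  define G where "G x z = indicator S z *\<^sub>R F x z" for x z
  have G_eq: "G x z = F x z" if "z \<in> S" for x z using that by (simp add: G_def)
  have conv: "convex_on UNIV (\<lambda>x. G x z)" for z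
  proof (cases "z \<in> S")
    case True
    then show ?thesis using assms(9) by (simp add: G_eq S_def)
  next
    case False
    then show ?thesis by (simp add: G_def convex_on_def)
  qed
  have int: "integrable P (G x)" for x
    using assms(10) unfolding set_integrable_def G_def S_def by blast
  have f_eq: "mean_fun P F = (\<lambda>x. \<integral>z. G x z \<partial>P)"
    by (rule ext) (simp only: mean_fun_def set_lebesgue_integral_def G_def S_def)
  have f_conv: "convex_on UNIV (mean_fun P F)"
    unfolding f_eq
  proof (rule convex_onI)
    fix t :: real and x y :: 'a
    assume t: "0 < t" "t < 1"
    have "(\<integral>z. G ((1 - t) *\<^sub>R x + t *\<^sub>R y) z \<partial>P) \<le> (\<integral>z. (1 - t) * G x z + t * G y z \<partial>P)"
      using t by (intro integral_mono int Bochner_Integration.integrable_add integrable_mult_right convex_onD[OF conv]) auto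
    then show "(\<integral>z. G ((1 - t) *\<^sub>R x + t *\<^sub>R y) z \<partial>P) \<le> (1 - t) * (\<integral>z. G x z \<partial>P) + t * (\<integral>z. G y z \<partial>P)"
      using int by simp
  qed simp
  have "continuous_on X (mean_fun P F)"
    using convex_on_continuous[OF open_UNIV f_conv] by (rule continuous_on_subset) simp
  then obtain x0 where x0: "x0 \<in> X" "\<And>x. x \<in> X \<Longrightarrow> mean_fun P F x0 \<le> mean_fun P F x"
    using continuous_attains_inf[OF X(3,1)] by blast
  have Opt: "Opt P F X = mean_fun P F x0"
    unfolding Opt_def using x0 by (intro cInf_eq_minimum) auto
  obtain h where h: "(mean_fun P F has_derivative (\<lambda>u. h \<bullet> u)) (at x0)"
    using real_has_derivative_inner assms(14) x0(1) by blast
  have L: "conj_norm nrm (g - h) \<le> subgrad_dev nrm P F x0 z"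
    if z: "z \<in> S" and g: "g \<in> subdiff (\<lambda>x. G x z) x0" for z g
  proof (rule conj_norm_le_subgrad_dev[OF nrm _ f_conv])
    show "convex_on UNIV (\<lambda>y. F y z)" using z assms(9) by (simp add: S_def)
    show "g \<in> subdiff (\<lambda>y. F y z) x0" using g by (simp add: G_eq[OF z])
    show "h \<in> subdiff (mean_fun P F) x0" by (rule gradient_in_subdiff[OF f_conv h])
  qed
  have m1: "(\<integral>\<^sup>+z. ennreal (exp ((G x0 z - mean_fun P F x0)\<^sup>2 / M1\<^sup>2)) \<partial>P) \<le> ennreal (exp 1)"
  proof -
    have "(\<integral>\<^sup>+z. ennreal (exp ((G x0 z - mean_fun P F x0)\<^sup>2 / M1\<^sup>2)) \<partial>P)
        = (\<integral>\<^sup>+z\<in>msupport P. ennreal (exp ((F x0 z - mean_fun P F x0)\<^sup>2 / M1\<^sup>2)) \<partial>P)"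
      using S_AE by (intro nn_integral_cong_AE) (auto simp: G_def S_def)
    then show ?thesis using assms(17) x0(1) by simp
  qed
  let ?Q = "PiM {1..N} (\<lambda>_::nat. P)"
  interpret Q: prob_space ?Q by (intro prob_space_PiM P)
  let ?lo = "mean_fun P F x0 - (\<mu>2 * M1 + (Omega_const nrm \<omega> * (1 + s\<^sup>2) + 2 * l) * M2 * min_radius nrm X) / sqrt (real N)"
  let ?hi = "mean_fun P F x0 + \<mu>1 * M1 / sqrt (real N)"
  let ?\<beta> = "exp (- (\<mu>1\<^sup>2 / (4 * tau_star))) + exp (- (\<mu>2\<^sup>2 / (4 * tau_star))) +
                 exp (- (real N * (s\<^sup>2 - 1))) + exp (- (l\<^sup>2 / (4 * tau_star)))"
  have "\<exists>A\<in>sets ?Q. measure ?Q A \<le> ?\<beta> \<and> (AE z in ?Q. z \<notin> A \<longrightarrow> Opt_SAA G X N z \<in> {?lo..?hi})"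
  proof (rule SAA_confidence_product[OF f_eq nrm dgf X P conv int x0 h L S_AE assms(15,16) m1])
    show "(\<integral>\<^sup>+z. ennreal (exp ((subgrad_dev nrm P F x0 z)\<^sup>2 / M2\<^sup>2)) * indicator S z \<partial>P) \<le> ennreal (exp 1)"
      using assms(18) x0(1) by (simp add: S_def)
  qed (use assms(19,21,22,23) in auto)
  then obtain A where A: "A \<in> sets ?Q" "measure ?Q A \<le> ?\<beta>"
    "AE z in ?Q. z \<notin> A \<longrightarrow> Opt_SAA G X N z \<in> {?lo..?hi}"
    by blast
  \<comment> \<open>The event of the theorem is the preimage of \<open>E\<close> under the sample map \<open>\<Phi>\<close>, whose law is \<open>?Q\<close>.\<close>
  define E where "E = {z \<in> space ?Q. (\<forall>t\<in>{1..N}. z t \<in> S) \<and> Opt_SAA G X N z \<in> {?lo..?hi}}"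
  have E: "E \<in> sets ?Q"
  proof -
    have "Opt_SAA G X N \<in> borel_measurable ?Q"
      by (rule Opt_SAA_measurable[OF conv borel_measurable_integrable[OF int] X(1,3)])
    then have "Opt_SAA G X N -` {?lo..?hi} \<inter> space ?Q \<in> sets ?Q"
      by (rule measurable_sets) simp
    moreover have "(\<Inter>t\<in>{1..N}. (\<lambda>z. z t) -` S \<inter> space ?Q) \<in> sets ?Q"
    proof (intro sets.finite_INT)
      show "(\<lambda>z. z t) -` S \<inter> space ?Q \<in> sets ?Q" if "t \<in> {1..N}" for t
        using measurable_component_singleton[OF that] S_borel by (rule measurable_sets)
    qed (use \<open>N > 0\<close> in auto)
    moreover have "E = (Opt_SAA G X N -` {?lo..?hi} \<inter> space ?Q) \<inter> (\<Inter>t\<in>{1..N}. (\<lambda>z. z t) -` S \<inter> space ?Q)"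
      using \<open>N > 0\<close> unfolding E_def by fastforce
    ultimately show ?thesis by (simp only: sets.Int)
  qed
  have "AE z in ?Q. \<forall>t\<in>{1..N}. z t \<in> S"
    by (intro AE_finite_allI AE_PiM_component[OF P _ S_AE]) auto
  then have "AE z in ?Q. z \<in> space ?Q - E \<longrightarrow> z \<in> A"
    using A(3) by eventually_elim (auto simp: E_def)
  then have "measure ?Q (space ?Q - E) \<le> measure ?Q A" by (rule Q.finite_measure_mono_AE[OF _ A(1)])
  then have prob_E: "1 - ?\<beta> \<le> measure ?Q E" using A(2) Q.prob_compl[OF E] by linarith
  define \<Phi> where "\<Phi> = (\<lambda>w. \<lambda>t\<in>{1..N}. \<xi> t w)"
  have rv: "\<xi> t \<in> measurable Pr borel" if "t \<in> {1..N}" for t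
    using assms(12) that unfolding Pr.indep_vars_def by auto
  have indep: "Pr.indep_vars (\<lambda>_. borel) \<xi> {1..N}"
    by (rule Pr.indep_vars_subset[OF assms(12)]) auto
  have sets_Q: "sets ?Q = sets (PiM {1..N} (\<lambda>_. borel))"
    by (intro sets_PiM_cong refl sets_P)
  have distr: "distr Pr (PiM {1..N} (\<lambda>_. borel)) \<Phi> = ?Q"
  proof -
    have "distr Pr (PiM {1..N} (\<lambda>_. borel)) \<Phi> = PiM {1..N} (\<lambda>t. distr Pr borel (\<xi> t))"
      using Pr.indep_vars_iff_distr_eq_PiM'[of "{1..N}" \<xi> "\<lambda>_. borel"] rv indep \<open>N > 0\<close> by (simp add: \<Phi>_def)
    also have "\<dots> = ?Q" using assms(13) by (intro PiM_cong) auto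
    finally show ?thesis .
  qed
  have \<Phi>: "\<Phi> \<in> measurable Pr (PiM {1..N} (\<lambda>_. borel))"
    unfolding \<Phi>_def by (intro measurable_restrict rv)
  have "{w \<in> space Pr. (\<forall>t\<in>{1..N}. \<xi> t w \<in> msupport P) \<and>
      Opt P F X \<in> {Low F X M1 \<mu>1 N (\<lambda>t. \<xi> t w)..Up nrm \<omega> F X M1 M2 \<mu>2 s l N (\<lambda>t. \<xi> t w)}} = \<Phi> -` E \<inter> space Pr"
  proof -
    have "Opt_SAA F X N (\<lambda>t. \<xi> t w) = Opt_SAA G X N (\<Phi> w)" if "\<forall>t\<in>{1..N}. \<xi> t w \<in> S" for w
      using that unfolding Opt_SAA_def
      by (intro arg_cong[where f=Inf] image_cong refl arg_cong2[where f="(*)"] sum.cong) (auto simp: \<Phi>_def G_eq)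
    moreover have "\<Phi> w \<in> space ?Q" if "w \<in> space Pr" for w
      using measurable_space[OF \<Phi> that] sets_eq_imp_space_eq[OF sets_Q] by simp
    ultimately show ?thesis
      unfolding E_def Opt Low_def Up_def S_def[symmetric] by (auto simp: \<Phi>_def algebra_simps)
  qed
  moreover have "measure Pr (\<Phi> -` E \<inter> space Pr) = measure ?Q E"
    using measure_distr[OF \<Phi>, of E] E unfolding distr sets_Q by simp
  ultimately show ?thesis using prob_E by (simp only:)
qed

end
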